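(* Let $A$ be a (nonempty) bounded subset of $\mathbb{R}^N$ such that there exist $D\ge0$, $\alpha>0$, and a nonconstant periodic function $G:\mathbb{R}\to[0,+\infty)$ with minimal period $T>0$, satisfying $$|A_t|=t^{N-D}\left(G(\log t^{-1})+O(t^\alpha)\right)\quad\text{as } t\to0^+.$$ Then $\dim_BA=D$, $G$ is continuous, and $A$ is Minkowski nondegenerate with lower and upper Minkowski contents given by $\mathcal M_*^D(A)=\min G$ and $\mathcal M^{*D}(A)=\max G$ (hence the range of $G|_{[0,T]}$ is $[\mathcal M_*^D(A),\mathcal M^{*D}(A)]$). Furthermore, the tube zeta function $\tilde\zeta_A$ has abscissa of convergence $D(\tilde\zeta_A)=D$ and possesses a unique meromorphic extension (still denoted by $\tilde\zeta_A$) to (at least) the open right half-plane $\{\operatorname{Re} s>D-\alpha\}$; that is, $D_{\rm mer}(\tilde\zeta_A)\le D-\alpha$. Moreover, the set of all poles of $\tilde\zeta_A$ located in this half-plane is $$\mathcal P(\tilde\zeta_A)=\left\{s_k=D+\frac{2\pi}{T}ik:\ \hat G_0\Big(\frac kT\Big)\ne0,\ k\in\mathbb{Z}\right\},$$ and this set coincides with the set $\dim_{PC}A=\mathcal P_c(\tilde\zeta_A)$ of principal complex dimensions of $A$. These poles are all simple, and the residue at each $s_k\in\mathcal P(\tilde\zeta_A)$ is $$\operatorname{res}(\tilde\zeta_A,s_k)=\frac1T\hat G_0\Big(\frac kT\Big).$$ If $s_k\in\mathcal P(\tilde\zeta_A)$, then $s_{-k}\in\mathcal P(\tilde\zeta_A)$,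 and $$|\operatorname{res}(\tilde\zeta_A,s_k)|\le\frac1T\int_0^TG(\tau)\,d\tau,\qquad \lim_{k\to\infty}\operatorname{res}(\tilde\zeta_A,s_k)=0.$$ In addition, $\mathcal P(\tilde\zeta_A)$ contains $s_0=D$, and $$\operatorname{res}(\tilde\zeta_A,D)=\frac1T\int_0^TG(\tau)\,d\tau.$$ In particular, $A$ is not Minkowski measurable and $$\mathcal M_*^D(A)<\operatorname{res}(\tilde\zeta_A,D)<\mathcal M^{*D}(A)<\infty.$$
   Context: $N\ge1$. For $A\subset\mathbb{R}^N$ nonempty and bounded, $d(x,A)$ is the Euclidean distance from $x$ to $A$, $A_t:=\{x\in\mathbb{R}^N: d(x,A)<t\}$, and $|A_t|$ is its $N$-dimensional Lebesgue measure. For $r\ge0$, $\mathcal M^{*r}(A)=\limsup_{t\to0^+}|A_t|/t^{N-r}$ and $\mathcal M_*^{r}(A)=\liminf_{t\to0^+}|A_t|/t^{N-r}$ are the upper and lower $r$-dimensional Minkowski contents. The upper (resp. lower) Minkowski dimension of $A$ is $\inf\{r>0:\mathcal M^{*r}(A)=0\}$ (resp. the same with $\mathcal M_*^r$); if they coincide, the common value is $\dim_BA$. $A$ is Minkowski nondegenerate if $0<\mathcal M_*^D(A)\le\mathcal M^{*D}(A)<\infty$ for some $D\ge 0$ (then $D=\dim_BA$), and Minkowski measurable if moreover $\mathcal M_*^D(A)=\mathcal M^{*D}(A)$. For a fixed $\delta>0$, the tube zeta function of $A$ is $\tilde\zeta_A(s)=\int_0^\delta t^{s-N-1}|A_t|\,dt$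 for $\operatorname{Re}s$ sufficiently large; its abscissa of convergence $D(\tilde\zeta_A)$ is the infimum of all real $\sigma\ge0$ such that the integral converges (absolutely) at $s=\sigma$. $D_{\rm mer}(f)$ is the infimum of all real $\sigma$ such that $f$ has a meromorphic extension to $\{\operatorname{Re}s>\sigma\}$. $\mathcal P_c(\tilde\zeta_A)$ is the set of poles of (the meromorphic extension of) $\tilde\zeta_A$ on the critical line $\{\operatorname{Re}s=D(\tilde\zeta_A)\}$. $\operatorname{res}(f,\omega)$ is the residue of $f$ at $\omega$ (equal to $0$ if $f$ is holomorphic at $\omega$). $G_0$ is the truncation of $G$ to $[0,T]$ (equal to $G$ on $[0,T]$ and $0$ elsewhere), and $\hat G_0(t)=\int_0^Te^{-2\pi i t\tau}G(\tau)\,d\tau$ is its Fourier transform. *)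

theory Defs
  imports "HOL-Complex_Analysis.Complex_Analysis"
begin

definition tube :: "'a::euclidean_space set \<Rightarrow> real \<Rightarrow> 'a set" where
  "tube A t = {x. infdist x A < t}"

definition tube_vol :: "'a::euclidean_space set \<Rightarrow> real \<Rightarrow> real" where
  "tube_vol A t = measure lebesgue (tube A t)"

definition upper_content :: "real \<Rightarrow> 'a::euclidean_space set \<Rightarrow> ereal" where
  "upper_content r A =
     Limsup (at_right 0) (\<lambda>t. ereal (tube_vol A t / t powr (real DIM('a) - r)))"

definition lower_content :: "real \<Rightarrow> 'a::euclidean_space set \<Rightarrow> ereal" where
  "lower_content r A =
     Liminf (at_right 0) (\<lambda>t. ereal (tube_vol A t / t powr (real DIM('a) - r)))"

definition upper_minkowski_dim :: "'a::euclidean_space set \<Rightarrow> ereal" where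
  "upper_minkowski_dim A = Inf (ereal ` {r. r > 0 \<and> upper_content r A = 0})"

definition lower_minkowski_dim :: "'a::euclidean_space set \<Rightarrow> ereal" where
  "lower_minkowski_dim A = Inf (ereal ` {r. r > 0 \<and> lower_content r A = 0})"

definition has_minkowski_dim :: "'a::euclidean_space set \<Rightarrow> real \<Rightarrow> bool" where
  "has_minkowski_dim A D \<longleftrightarrow>
     upper_minkowski_dim A = ereal D \<and> lower_minkowski_dim A = ereal D"

definition minkowski_nondegenerate :: "'a::euclidean_space set \<Rightarrow> bool" where
  "minkowski_nondegenerate A \<longleftrightarrow>
     (\<exists>D\<ge>0. 0 < lower_content D A \<and> lower_content D A \<le> upper_content D A \<and>
            upper_content D A < \<infinity>)"

definition minkowski_measurable :: "'a::euclidean_space set \<Rightarrow> bool" where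
  "minkowski_measurable A \<longleftrightarrow>
     (\<exists>D\<ge>0. 0 < lower_content D A \<and> lower_content D A = upper_content D A \<and>
            upper_content D A < \<infinity>)"

definition tube_zeta :: "real \<Rightarrow> 'a::euclidean_space set \<Rightarrow> complex \<Rightarrow> complex" where
  "tube_zeta \<delta> A s =
     (LINT t:{0<..<\<delta>}|lborel.
        complex_of_real t powr (s - of_nat DIM('a) - 1) * complex_of_real (tube_vol A t))"

definition tube_zeta_abscissa :: "real \<Rightarrow> 'a::euclidean_space set \<Rightarrow> ereal" where
  "tube_zeta_abscissa \<delta> A =
     Inf (ereal ` {\<sigma>. \<sigma> \<ge> 0 \<and>
       set_integrable lborel {0<..<\<delta>} (\<lambda>t. t powr (\<sigma> - real DIM('a) - 1) * tube_vol A t)})"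

definition half_plane :: "ereal \<Rightarrow> complex set" where
  "half_plane \<sigma> = {s. \<sigma> < ereal (Re s)}"

text \<open>A function \<open>f\<close> that is only meaningful on \<open>U\<close> is extended to \<open>F\<close> on \<open>V\<close>. Requiring
  \<open>F\<close> to be nicely meromorphic fixes its values at removable singularities (by continuity) and
  at poles (by the value 0), so that \<open>F\<close> is determined pointwise on \<open>V\<close> and the uniqueness of
  an extension can be expressed as equality on all of \<open>V\<close>.\<close>

definition meromorphic_extension ::
    "(complex \<Rightarrow> complex) \<Rightarrow> complex set \<Rightarrow> complex set \<Rightarrow> (complex \<Rightarrow> complex) \<Rightarrow> bool" where
  "meromorphic_extension f U V F \<longleftrightarrow>
     U \<subseteq> V \<and> F nicely_meromorphic_on V \<and> (\<forall>s\<in>U. F s = f s)"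

text \<open>Extended-real valued, since the abscissa is \<open>-\<infinity>\<close> for functions that
  extend to the whole plane.\<close>

definition mer_abscissa :: "(complex \<Rightarrow> complex) \<Rightarrow> complex set \<Rightarrow> ereal" where
  "mer_abscissa f U =
     Inf (ereal ` {\<sigma>. \<exists>F. meromorphic_extension f U (half_plane (ereal \<sigma>)) F})"

definition poles_in :: "(complex \<Rightarrow> complex) \<Rightarrow> complex set \<Rightarrow> complex set" where
  "poles_in F V = {s\<in>V. is_pole F s}"

text \<open>The principal complex dimensions; \<open>Z\<close> is the meromorphic extension
  of the tube zeta function.\<close>

definition principal_complex_dims ::
    "real \<Rightarrow> 'a::euclidean_space set \<Rightarrow> (complex \<Rightarrow> complex) \<Rightarrow> complex set" where
  "principal_complex_dims \<delta> A Z = poles_in Z {s. ereal (Re s) = tube_zeta_abscissa \<delta> A}"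

definition minimal_period :: "(real \<Rightarrow> 'b) \<Rightarrow> real \<Rightarrow> bool" where
  "minimal_period G T \<longleftrightarrow>
     T > 0 \<and> (\<forall>x. G (x + T) = G x) \<and> (\<forall>T'. 0 < T' \<and> T' < T \<longrightarrow> \<not> (\<forall>x. G (x + T') = G x))"

definition truncation :: "real \<Rightarrow> (real \<Rightarrow> real) \<Rightarrow> real \<Rightarrow> real" where
  "truncation T G \<tau> = (if \<tau> \<in> {0..T} then G \<tau> else 0)"

definition fourier_transform :: "(real \<Rightarrow> real) \<Rightarrow> real \<Rightarrow> complex" where
  "fourier_transform g t =
     (LINT \<tau>|lborel. exp (- 2 * of_real pi * \<i> * of_real t * of_real \<tau>) * of_real (g \<tau>))"

end

(*
  Put f(x) = |A_t| / t^(N-D) with t = exp(-x). The hypothesis says that the translates f(x + nT)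
  converge to G(x) uniformly for x > a. Since |A_t| is continuous in t (level sets of the distance
  function are null), G is continuous, and since |A_t| is monotone, G(x + u) <= exp((N-D)u) G(x)
  for u >= 0; so a zero of the periodic function G would force G = 0, and G is bounded below by a
  positive constant. The contents and dimensions are read off from this.

  On (0,b) with b small, |A_t| t^(-N) = t^(-D) G(log 1/t) + O(t^(alpha-D)). The Mellin transform of
  the error is holomorphic for Re s > D - alpha. With z = s - D, scaling t by exp(-T) shows that the
  transform of the main term times 1 - exp(-Tz) is the entire function
  J(z) = integral of exp(-zx) G(x) over one period. Hence all poles are simple zeros of the
  denominator, with residue J(2 pi i k/T)/T, which is the k-th Fourier coefficient of G; it tends
  to 0 by the Riemann-Lebesgue lemma.
*)
theory Submission
  imports Defs
begin

section \<open>Volume of tubes\<close>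

text \<open>The zeta function is not continued in stages. For Re s > D, where all integrals converge
  absolutely, it is identified with one explicit quotient whose numerator \<open>zeta_num\<close> is
  holomorphic on the whole half-plane Re s > \<open>D - \<alpha>\<close>. Bringing the transform of
  the error over the common denominator multiplies it by a factor that vanishes at every zero of the
  denominator, so the residues see the periodic part only. Its period integral depends in general on
  the starting point of the period, hence on \<open>\<delta>\<close>; at the zeros of the
  denominator its integrand is itself periodic and this dependence disappears. Two features shape
  the bookkeeping. The asymptotics are known only near 0 while \<open>\<delta>\<close> is arbitrary,
  so the periodic part is cut off and the rest is charged to the error. A zero of the denominator
  whose Fourier coefficient vanishes is a removable singularity, which the pointwise notion of
  extension requires to be filled by its limit.\<close>

lemma infdist_closure_eq: "infdist x (closure A) = infdist x A"
  by (simp add: infdist_eq_setdist)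

text \<open>Every nearest point a in \<open>K\<close> of a level-set point satisfies dist c a < t.
  By convexity of the distance to a, moving from the level-set point towards \<open>c\<close> brings
  the distance strictly below t, so every ray from \<open>c\<close> meets the level set at most
  once.\<close>

lemma negligible_infdist_level_small:
  fixes K :: "'a::euclidean_space set"
  assumes K: "closed K" "c \<in> K" "K \<subseteq> ball c t"
  shows "negligible {x. infdist x K = t}"
proof (rule starlike_negligible_strong[where a = c])
  show "closed {x. infdist x K = t}"
    by (intro closed_Collect_eq continuous_intros)
next
  fix r :: real and x :: 'a
  assume r: "0 \<le> r" "r < 1" and x: "c + x \<in> {x. infdist x K = t}"
  have "K \<noteq> {}" using K by auto
  then obtain a where a: "a \<in> K" "infdist (c + x) K = dist (c + x) a"
    using infdist_attains_inf[OF K(1)] by blast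
  have t: "dist (c + x) a = t" using x a by simp
  have ca: "dist c a < t" using a K by auto
  have "dist (c + r *\<^sub>R x) a = norm ((1 - r) *\<^sub>R (c - a) + r *\<^sub>R (c + x - a))"
    by (simp add: dist_norm algebra_simps)
  also have "\<dots> \<le> (1 - r) * norm (c - a) + r * norm (c + x - a)"
    using r by (intro order.trans[OF norm_triangle_ineq]) simp
  also have "\<dots> = (1 - r) * dist c a + r * t" using t by (simp add: dist_norm)
  also have "\<dots> < (1 - r) * t + r * t" using r ca by simp
  finally have "dist (c + r *\<^sub>R x) a < t" by (simp add: algebra_simps)
  then have "infdist (c + r *\<^sub>R x) K < t" using infdist_le[OF a(1)] by (meson le_less_trans)
  then show "c + r *\<^sub>R x \<notin> {x. infdist x K = t}" by simp
qed

text \<open>Cutting \<open>A\<close> into pieces of diameter below \<open>t\<close> makes the level sets of the pieces starlike.\<close>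

lemma negligible_infdist_level:
  fixes A :: "'a::euclidean_space set"
  assumes A: "bounded A" and t: "t > 0"
  shows "negligible {x. infdist x A = t}"
proof (cases "A = {}")
  case True
  then show ?thesis using t by (simp add: infdist_def)
next
  case False
  let ?K = "closure A"
  have comp: "compact ?K" using A by simp
  \<comment> \<open>Open balls are needed for the finite subcover; the closed balls of the same
    radius t/2 < t then cut out closed pieces that still lie in \<open>ball c t\<close>.\<close>
  have "?K \<subseteq> (\<Union>c\<in>?K. ball c (t/2))" using t by auto
  then obtain F where F: "F \<subseteq> ?K" "finite F" "?K \<subseteq> (\<Union>c\<in>F. ball c (t/2))"
    using compactE_image[OF comp, of ?K "\<lambda>c. ball c (t/2)"] by auto
  \<comment> \<open>A nearest point of the closure lies in one of the pieces, and the distance to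
    that piece is then the distance to the whole set.\<close>
  have "{x. infdist x A = t} \<subseteq> (\<Union>c\<in>F. {x. infdist x (?K \<inter> cball c (t/2)) = t})"
  proof
    fix x assume "x \<in> {x. infdist x A = t}"
    then have x: "infdist x ?K = t" using False by (simp add: infdist_closure_eq)
    obtain a where a: "a \<in> ?K" "infdist x ?K = dist x a"
      using infdist_attains_inf[of ?K x] False by auto
    obtain c where c: "c \<in> F" "a \<in> ball c (t/2)" using F a by blast
    have "infdist x (?K \<inter> cball c (t/2)) \<le> dist x a"
      using a c by (intro infdist_le) auto
    moreover have "infdist x ?K \<le> infdist x (?K \<inter> cball c (t/2))"
      using a c by (intro infdist_mono) auto
    ultimately have "infdist x (?K \<inter> cball c (t/2)) = t"
      using a x by simp
    then show "x \<in> (\<Union>c\<in>F. {x. infdist x (?K \<inter> cball c (t/2)) = t})"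
      using c by blast
  qed
  moreover have "negligible (\<Union>c\<in>F. {x. infdist x (?K \<inter> cball c (t/2)) = t})"
  proof (rule negligible_Union)
    show "finite ((\<lambda>c. {x. infdist x (?K \<inter> cball c (t/2)) = t}) ` F)" using F by simp
    fix S assume "S \<in> (\<lambda>c. {x. infdist x (?K \<inter> cball c (t/2)) = t}) ` F"
    then obtain c where c: "c \<in> F" "S = {x. infdist x (?K \<inter> cball c (t/2)) = t}" by auto
    show "negligible S" unfolding c(2)
      using c(1) F t by (intro negligible_infdist_level_small[where c = c]) (auto intro: closed_Int)
  qed
  ultimately show ?thesis by (rule negligible_subset[rotated])
qed

section \<open>Measurability, monotonicity and continuity of the tube volume\<close>

lemma open_tube: "open (tube A t)"
  unfolding tube_def by (intro open_Collect_less continuous_intros)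

lemma tube_mono: "s \<le> t \<Longrightarrow> tube A s \<subseteq> tube A t"
  by (auto simp: tube_def)

lemma bounded_tube:
  assumes "bounded A" "A \<noteq> {}"
  shows "bounded (tube A t)"
proof -
  obtain a where a: "\<And>x. x \<in> A \<Longrightarrow> norm x \<le> a" using assms(1) by (auto simp: bounded_iff)
  have "norm x \<le> a + t" if "x \<in> tube A t" for x
  proof -
    have "infdist x (closure A) < t" using that assms by (simp add: tube_def infdist_closure_eq)
    moreover obtain y where y: "y \<in> closure A" "infdist x (closure A) = dist x y"
      using infdist_attains_inf[of "closure A" x] assms by auto
    moreover have "norm y \<le> a"
      using y a closure_minimal[of A "cball 0 a"] by (auto simp: subset_iff)
    ultimately show ?thesis using norm_triangle_ineq2[of x y] by (simp add: dist_norm)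
  qed
  then show ?thesis by (auto simp: bounded_iff)
qed

lemma lmeasurable_tube: "bounded A \<Longrightarrow> A \<noteq> {} \<Longrightarrow> tube A t \<in> lmeasurable"
  by (intro lmeasurable_open bounded_tube open_tube)

lemma tube_vol_nonneg: "tube_vol A t \<ge> 0"
  by (simp add: tube_vol_def)

lemma tube_vol_mono:
  "bounded A \<Longrightarrow> A \<noteq> {} \<Longrightarrow> s \<le> t \<Longrightarrow> tube_vol A s \<le> tube_vol A t"
  unfolding tube_vol_def
  by (intro measure_mono_fmeasurable tube_mono lmeasurable_tube fmeasurableD)

text \<open>If the radii converge to t > 0, the indicators of the tubes converge at each point off
  the level set of t, which is null; dominated convergence does the rest.\<close>

lemma continuous_on_tube_vol:
  assumes A: "bounded A" "A \<noteq> {}"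
  shows "continuous_on {0<..} (tube_vol A)"
proof -
  \<comment> \<open>The upper end \<open>b\<close> supplies the common dominating tube. Radius 0
    stays excluded: its level set is the closure of \<open>A\<close>, which may have positive
    measure.\<close>
  have "continuous_on {0<..<b} (tube_vol A)" for b
  proof (subst continuous_on_sequentially, safe)
    fix u t assume u: "\<forall>n. u n \<in> {0<..<b}" and t: "t \<in> {0<..<b}" and lim: "u \<longlonglongrightarrow> t"
    have "(\<lambda>n. \<integral>x. indicat_real (tube A (u n)) x \<partial>lebesgue) \<longlonglongrightarrow> (\<integral>x. indicat_real (tube A t) x \<partial>lebesgue)"
    proof (rule integral_dominated_convergence)
      show "integrable lebesgue (indicat_real (tube A b))"
        using lmeasurable_tube[OF A, of b] by (simp add: lmeasurable_iff_integrable)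
      show "AE x in lebesgue. norm (indicat_real (tube A (u n)) x) \<le> indicat_real (tube A b) x" for n
        using u[THEN spec[of _ n]] by (auto simp: tube_def indicator_def)
      have "AE x in lebesgue. infdist x A \<noteq> t"
        using negligible_infdist_level[OF A(1), of t] t
        by (auto simp: eventually_ae_filter_negligible)
      then show "AE x in lebesgue. (\<lambda>n. indicat_real (tube A (u n)) x) \<longlonglongrightarrow> indicat_real (tube A t) x"
      proof eventually_elim
        case (elim x)
        have "\<forall>\<^sub>F n in sequentially. indicat_real (tube A (u n)) x = indicat_real (tube A t) x"
        proof (cases "infdist x A < t")
          case True
          show ?thesis using order_tendstoD(1)[OF lim True]
            by eventually_elim (use True in \<open>auto simp: tube_def indicator_def\<close>)
        next
          case False
          then have "\<forall>\<^sub>F n in sequentially. u n < infdist x A"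
            using elim by (intro order_tendstoD(2)[OF lim]) simp
          then show ?thesis
            by eventually_elim (use False in \<open>auto simp: tube_def indicator_def\<close>)
        qed
        then show ?case by (rule tendsto_eventually)
      qed
    qed (auto intro: borel_measurable_indicator fmeasurableD lmeasurable_tube[OF A])
    then show "(tube_vol A \<circ> u) \<longlonglongrightarrow> tube_vol A t"
      by (simp add: tube_vol_def o_def lmeasurable_tube[OF A])
  qed
  then have "continuous_on (\<Union>b. {0<..<b}) (tube_vol A)"
    by (intro continuous_on_open_UN) auto
  moreover have "(\<Union>b. {0<..<b::real}) = {0<..}"
    using gt_ex by fastforce
  ultimately show ?thesis by simp
qed

section \<open>Mellin transforms\<close>

lemma set_integrable_powr:
  assumes "a > -1"
  shows "set_integrable lborel {0<..<b::real} (\<lambda>t. t powr a)"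
proof (cases "b > 0")
  case True
  have "(\<lambda>t. t powr a) absolutely_integrable_on {0..b}"
    using integrable_on_powr_from_0[OF assms, of b] True
    by (subst absolutely_integrable_on_iff_nonneg) auto
  then have "integrable lborel (\<lambda>t. indicat_real {0..b} t *\<^sub>R t powr a)"
    unfolding set_integrable_def by (subst (asm) integrable_completion) auto
  then have "set_integrable lborel {0..b} (\<lambda>t. t powr a)" by (simp add: set_integrable_def)
  then show ?thesis by (rule set_integrable_subset) auto
qed (simp add: set_integrable_def)

lemma not_set_integrable_inverse:
  assumes "b > (0::real)"
  shows "\<not> set_integrable lborel {0<..<b} (\<lambda>t. 1 / t)"
proof
  assume int: "set_integrable lborel {0<..<b} (\<lambda>t. 1 / t)"
  define K where "K = (LINT t:{0<..<b}|lborel. 1 / t)"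
  \<comment> \<open>Chosen so that the integral of 1/t from \<open>\<epsilon>\<close> to b/2 is
    exactly \<open>\<bar>K\<bar> + 1\<close>, more than the supposed total integral
    \<open>K\<close>.\<close>
  define \<epsilon> where "\<epsilon> = b / 2 * exp (- \<bar>K\<bar> - 1)"
  have \<epsilon>: "0 < \<epsilon>" "\<epsilon> \<le> b / 2" using assms by (auto simp: \<epsilon>_def mult_le_cancel_left1)
  have sub: "set_integrable lborel {\<epsilon>..b/2} (\<lambda>t. 1 / t)"
    by (rule set_integrable_subset[OF int]) (use \<epsilon> assms in auto)
  have "((\<lambda>t. 1 / t) has_integral (ln (b/2) - ln \<epsilon>)) {\<epsilon>..b/2}"
    using \<epsilon> by (intro fundamental_theorem_of_calculus)
      (auto intro!: derivative_eq_intros simp flip: has_real_derivative_iff_has_vector_derivative)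
  then have "(LINT t:{\<epsilon>..b/2}|lborel. 1 / t) = ln (b/2) - ln \<epsilon>"
    using set_borel_integral_eq_integral(2)[OF sub] by (simp add: integral_unique)
  also have "\<dots> = \<bar>K\<bar> + 1" using assms by (simp add: \<epsilon>_def ln_mult ln_div)
  finally have "(LINT t:{\<epsilon>..b/2}|lborel. 1 / t) = \<bar>K\<bar> + 1" .
  moreover have "(LINT t:{\<epsilon>..b/2}|lborel. 1 / t) \<le> K"
    unfolding K_def set_lebesgue_integral_def
    using sub int \<epsilon> assms
    by (intro integral_mono) (auto simp: set_integrable_def indicator_def)
  ultimately show False by linarith
qed

lemma of_real_powr_eq_exp:
  "t > 0 \<Longrightarrow> complex_of_real t powr s = exp (s * of_real (ln t))"
  by (simp add: powr_def Ln_of_real)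

lemma norm_exp_minus_1_le: "norm (exp z - 1) \<le> exp \<bar>Re z\<bar> * norm z" for z :: complex
  using Taylor_exp[of z 0] by simp

text \<open>A logarithm costs an arbitrarily small power: for x = ln t this absorbs the factor that
  differentiating a power of t in its exponent brings down.\<close>

lemma abs_le_exp_div: "r > 0 \<Longrightarrow> \<bar>x\<bar> \<le> exp (r * \<bar>x\<bar>) / r" for x :: real
  using exp_ge_add_one_self[of "r * \<bar>x\<bar>"] by (simp add: field_simps del: exp_ge_add_one_self)

section \<open>Holomorphy of the Mellin transform of a function with a power bound\<close>

context
  fixes h :: "real \<Rightarrow> real" and b \<beta> C :: real
  assumes h [measurable]: "h \<in> borel_measurable borel"
    and h_bound: "\<And>t. 0 < t \<Longrightarrow> t < b \<Longrightarrow> \<bar>h t\<bar> \<le> C * t powr (- \<beta>)"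
begin

text \<open>The exponential form is directly accessible to measurability and differentiation in s;
  it agrees with \<open>powr\<close> for t > 0, and elsewhere the indicator vanishes.\<close>

lemma mellin_eq:
  "(LINT t:{0<..<b}|lborel. complex_of_real t powr (s - 1) * of_real (h t)) =
   (LINT t|lborel. indicat_real {0<..<b} t *\<^sub>R (exp ((s - 1) * of_real (ln t)) * of_real (h t)))"
  unfolding set_lebesgue_integral_def
  by (intro Bochner_Integration.integral_cong) (auto simp: indicator_def of_real_powr_eq_exp)

lemma mellin_norm_bound:
  assumes "0 < t" "t < b"
  shows "norm (exp ((s - 1) * of_real (ln t)) * of_real (h t)) \<le> C * t powr (Re s - 1 - \<beta>)"
proof -
  have "norm (exp ((s - 1) * of_real (ln t)) * of_real (h t)) = t powr (Re s - 1) * \<bar>h t\<bar>"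
    using assms by (simp add: norm_mult powr_def)
  also have "\<dots> \<le> t powr (Re s - 1) * (C * t powr (- \<beta>))"
    using assms by (intro mult_left_mono h_bound) auto
  also have "\<dots> = C * t powr (Re s - 1 - \<beta>)"
    by (simp add: mult.left_commute flip: powr_add)
  finally show ?thesis .
qed

lemma mellin_integrable_exp:
  assumes "Re s > \<beta>"
  shows "integrable lborel (\<lambda>t. indicat_real {0<..<b} t *\<^sub>R (exp ((s - 1) * of_real (ln t)) * of_real (h t)))"
proof (rule Bochner_Integration.integrable_bound)
  show "integrable lborel (\<lambda>t. C * (indicat_real {0<..<b} t *\<^sub>R t powr (Re s - 1 - \<beta>)))"
    using set_integrable_powr[of "Re s - 1 - \<beta>" b] assms
    by (intro integrable_mult_right) (auto simp: set_integrable_def)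
  show "AE t in lborel. norm (indicat_real {0<..<b} t *\<^sub>R (exp ((s - 1) * of_real (ln t)) * of_real (h t)))
      \<le> norm (C * (indicat_real {0<..<b} t *\<^sub>R t powr (Re s - 1 - \<beta>)))"
  proof (rule always_eventually, rule allI)
    fix t show "norm (indicat_real {0<..<b} t *\<^sub>R (exp ((s - 1) * of_real (ln t)) * of_real (h t)))
      \<le> norm (C * (indicat_real {0<..<b} t *\<^sub>R t powr (Re s - 1 - \<beta>)))"
      using order.trans[OF mellin_norm_bound[of t s] abs_ge_self]
      by (cases "t \<in> {0<..<b}") auto
  qed
qed measurable

lemma mellin_integrable:
  assumes "Re s > \<beta>"
  shows "set_integrable lborel {0<..<b} (\<lambda>t. complex_of_real t powr (s - 1) * of_real (h t))"
proof -
  have "(\<lambda>t. indicat_real {0<..<b} t *\<^sub>R (complex_of_real t powr (s - 1) * of_real (h t))) =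
        (\<lambda>t. indicat_real {0<..<b} t *\<^sub>R (exp ((s - 1) * of_real (ln t)) * of_real (h t)))"
    by (auto simp: indicator_def of_real_powr_eq_exp)
  then show ?thesis using mellin_integrable_exp[OF assms] by (simp add: set_integrable_def)
qed

text \<open>Differentiation under the integral by dominated convergence of the difference quotients,
  along arbitrary sequences tending to 0.\<close>

lemma mellin_has_field_derivative:
  assumes z: "Re z > \<beta>"
  shows "((\<lambda>s. LINT t:{0<..<b}|lborel. complex_of_real t powr (s - 1) * of_real (h t)) has_field_derivative
    (LINT t|lborel. indicat_real {0<..<b} t *\<^sub>R (of_real (ln t) * exp ((z - 1) * of_real (ln t)) * of_real (h t))))
    (at z)"
proof -
  define K :: "complex \<Rightarrow> real \<Rightarrow> complex" where "K = (\<lambda>s t. indicat_real {0<..<b} t *\<^sub>R (exp ((s - 1) * of_real (ln t)) * of_real (h t)))"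
  \<comment> \<open>With this \<open>r\<close> the kernel at \<open>z\<close> is bounded by C
    t^(4r-1). The difference quotient in w with |w| < r adds two factors exp(r |ln t|): one bounds
    exp(w ln t), the other absorbs ln t at the price 1/r.\<close>
  define r where "r = (Re z - \<beta>) / 4"
  have r: "r > 0" using z by (simp add: r_def)
  \<comment> \<open>The two factors shift the exponent 4r-1 by 2r, upwards if ln t \<ge> 0 and
    downwards otherwise. The sum of both powers covers both signs, and both exponents exceed
    -1.\<close>
  define W where "W = (\<lambda>t. C / r * (indicat_real {0<..<b} t *\<^sub>R t powr (2 * r - 1) +
                                 indicat_real {0<..<b} t *\<^sub>R t powr (6 * r - 1)))"
  have W: "integrable lborel W"
    unfolding W_def
    using set_integrable_powr[of "2 * r - 1" b] set_integrable_powr[of "6 * r - 1" b] r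
    by (intro integrable_mult_right Bochner_Integration.integrable_add) (auto simp: set_integrable_def)
  have W_bound: "norm ((K (z + w) t - K z t) / w) \<le> W t" if w: "w \<noteq> 0" "norm w < r" for w t
  proof (cases "t \<in> {0<..<b}")
    case True
    then have t: "0 < t" "t < b" by auto
    define L where "L = ln t"
    have C: "0 \<le> C"
    proof -
      have "0 \<le> C * t powr (- \<beta>)" using h_bound[OF t] by linarith
      then show ?thesis using t by (simp add: zero_le_mult_iff)
    qed
    have "(K (z + w) t - K z t) / w =
        (exp ((z - 1) * of_real L) * of_real (h t)) * ((exp (w * of_real L) - 1) / w)"
    proof -
      have "exp ((z + w - 1) * of_real L) = exp ((z - 1) * of_real L) * exp (w * of_real L)"
        unfolding exp_add[symmetric] by (simp add: algebra_simps)
      then show ?thesis using True unfolding K_def L_def[symmetric] by (simp add: algebra_simps)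
    qed
    then have "norm ((K (z + w) t - K z t) / w) =
        norm (exp ((z - 1) * of_real L) * of_real (h t)) * (norm (exp (w * of_real L) - 1) / norm w)"
      by (simp only: norm_mult norm_divide)
    also have "\<dots> \<le> (C * t powr (Re z - 1 - \<beta>)) * (exp (r * \<bar>L\<bar>) * (exp (r * \<bar>L\<bar>) / r))"
    proof (rule mult_mono)
      show "norm (exp ((z - 1) * of_real L) * of_real (h t)) \<le> C * t powr (Re z - 1 - \<beta>)"
        unfolding L_def by (rule mellin_norm_bound[OF t])
      have "norm (exp (w * of_real L) - 1) / norm w \<le> exp (\<bar>Re w * L\<bar>) * \<bar>L\<bar>"
        using norm_exp_minus_1_le[of "w * of_real L"] w by (simp add: field_simps norm_mult)
      also have "\<dots> \<le> exp (r * \<bar>L\<bar>) * (exp (r * \<bar>L\<bar>) / r)"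
      proof (rule mult_mono)
        show "exp \<bar>Re w * L\<bar> \<le> exp (r * \<bar>L\<bar>)"
          using w abs_Re_le_cmod[of w] by (auto simp: abs_mult intro!: mult_right_mono)
      qed (use abs_le_exp_div[OF r, of L] in auto)
      finally show "norm (exp (w * of_real L) - 1) / norm w \<le> exp (r * \<bar>L\<bar>) * (exp (r * \<bar>L\<bar>) / r)" .
    qed (use C in auto)
    also have "\<dots> = C / r * (t powr (4 * r - 1) * exp (2 * r * \<bar>L\<bar>))"
    proof -
      have 1: "Re z - 1 - \<beta> = 4 * r - 1" by (simp add: r_def)
      have 2: "exp (r * \<bar>L\<bar>) * (exp (r * \<bar>L\<bar>) / r) = exp (2 * r * \<bar>L\<bar>) / r"
        by (simp flip: exp_add)
      show ?thesis unfolding 1 2 by (simp only: times_divide_eq_left times_divide_eq_right mult.assoc)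
    qed
    also have "\<dots> \<le> C / r * (t powr (2 * r - 1) + t powr (6 * r - 1))"
    proof (rule mult_left_mono)
      have "t powr (4 * r - 1) * exp (2 * r * \<bar>L\<bar>) = exp ((4 * r - 1) * L + 2 * r * \<bar>L\<bar>)"
        using t by (simp add: powr_def L_def exp_add)
      also have "\<dots> \<le> exp ((2 * r - 1) * L) + exp ((6 * r - 1) * L)"
        by (cases "L \<ge> 0") (auto simp: algebra_simps intro: add_increasing add_increasing2)
      finally show "t powr (4 * r - 1) * exp (2 * r * \<bar>L\<bar>) \<le> t powr (2 * r - 1) + t powr (6 * r - 1)"
        using t by (simp add: powr_def L_def)
    qed (use C r in auto)
    finally show ?thesis using True by (simp add: W_def)
  qed (simp add: K_def W_def)
  have diff: "((\<lambda>w. (K (z + w) t - K z t) / w) \<longlongrightarrow>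
      indicat_real {0<..<b} t *\<^sub>R (of_real (ln t) * exp ((z - 1) * of_real (ln t)) * of_real (h t))) (at 0)" for t
  proof -
    have "((\<lambda>s. K s t) has_field_derivative
      indicat_real {0<..<b} t *\<^sub>R (of_real (ln t) * exp ((z - 1) * of_real (ln t)) * of_real (h t))) (at z)"
      unfolding K_def scaleR_conv_of_real
      by (auto intro!: derivative_eq_intros)
    then show ?thesis by (simp add: DERIV_def)
  qed
  have "((\<lambda>w. ((LINT t|lborel. K (z + w) t) - (LINT t|lborel. K z t)) / w) \<longlongrightarrow>
    (LINT t|lborel. indicat_real {0<..<b} t *\<^sub>R (of_real (ln t) * exp ((z - 1) * of_real (ln t)) * of_real (h t)))) (at 0)"
    (is "(?Q \<longlongrightarrow> ?L) (at 0)")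
    unfolding tendsto_at_iff_sequentially
  proof safe
    fix X :: "nat \<Rightarrow> complex"
    assume X: "\<forall>i. X i \<in> UNIV - {0}" and X0: "X \<longlonglongrightarrow> 0"
    obtain n0 where n0: "\<And>n. n \<ge> n0 \<Longrightarrow> norm (X n) < r"
      using LIMSEQ_D[OF X0 r] by auto
    have lim: "(\<lambda>n. LINT t|lborel. (K (z + X (n + n0)) t - K z t) / X (n + n0)) \<longlonglongrightarrow> ?L"
    proof (rule integral_dominated_convergence[OF _ _ W])
      show "AE t in lborel. (\<lambda>n. (K (z + X (n + n0)) t - K z t) / X (n + n0)) \<longlonglongrightarrow>
         indicat_real {0<..<b} t *\<^sub>R (of_real (ln t) * exp ((z - 1) * of_real (ln t)) * of_real (h t))"
      proof (rule always_eventually, rule allI)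
        fix t
        have "(\<lambda>n. X (n + n0)) \<longlonglongrightarrow> 0" using X0 by (rule LIMSEQ_ignore_initial_segment)
        then have "filterlim (\<lambda>n. X (n + n0)) (at 0) sequentially"
          using X by (auto simp: filterlim_at)
        from filterlim_compose[OF diff this]
        show "(\<lambda>n. (K (z + X (n + n0)) t - K z t) / X (n + n0)) \<longlonglongrightarrow>
         indicat_real {0<..<b} t *\<^sub>R (of_real (ln t) * exp ((z - 1) * of_real (ln t)) * of_real (h t))" .
      qed
      show "AE t in lborel. norm ((K (z + X (n + n0)) t - K z t) / X (n + n0)) \<le> W t" for n
        using W_bound[of "X (n + n0)"] X n0[of "n + n0"] by auto
    qed (auto simp: K_def)
    have eq: "(LINT t|lborel. (K (z + X (n + n0)) t - K z t) / X (n + n0)) = ?Q (X (n + n0))" for n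
    proof -
      have "norm (X (n + n0)) < r" using n0 by simp
      then have "Re (z + X (n + n0)) > \<beta>"
        using abs_Re_le_cmod[of "X (n + n0)"] z by (simp add: r_def)
      then have "integrable lborel (K (z + X (n + n0)))" "integrable lborel (K z)"
        using mellin_integrable_exp z unfolding K_def by blast+
      then show ?thesis by simp
    qed
    have "(\<lambda>n. ?Q (X (n + n0))) \<longlonglongrightarrow> ?L"
      using lim unfolding eq .
    then show "(?Q \<circ> X) \<longlonglongrightarrow> ?L" unfolding o_def by (rule LIMSEQ_offset)
  qed
  then show ?thesis unfolding mellin_eq DERIV_def K_def by simp
qed

lemma mellin_holomorphic:
  "(\<lambda>s. LINT t:{0<..<b}|lborel. complex_of_real t powr (s - 1) * of_real (h t)) holomorphic_on {s. Re s > \<beta>}"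
  using mellin_has_field_derivative
  by (auto simp: holomorphic_on_def field_differentiable_def intro: has_field_derivative_at_within)

end

section \<open>Periodic functions\<close>

lemma exp_two_pi_int: "exp (2 * of_real pi * \<i> * of_int k) = (1 :: complex)"
  using exp_integer_2pi[of "of_int k"] by (simp add: mult_ac)

text \<open>The integral over a moving window of length \<open>T\<close> has derivative f(x + T) -
  f(x) = 0.\<close>

lemma integral_periodic:
  fixes f :: "real \<Rightarrow> 'a::euclidean_space"
  assumes f: "continuous_on UNIV f" and per: "\<And>x. f (x + T) = f x" and T: "T > 0"
  shows "integral {a..a + T} f = integral {0..T} f"
proof -
  \<comment> \<open>Strictly below both \<open>a\<close> and 0, so that the two windows to be
    compared start in the open half-line \<open>S\<close>, where the antiderivative \<open>u\<close>
    is differentiable.\<close>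
  define m where "m = min a 0 - 1"
  define u where "u = (\<lambda>x. integral {m..x} f)"
  define S where "S = {m<..}"
  have der: "(u has_vector_derivative f x) (at x)" if "x \<in> S" for x
  proof -
    have "(u has_vector_derivative f x) (at x within {m..x + 1})"
      unfolding u_def using that
      by (intro integral_has_vector_derivative continuous_on_subset[OF f]) (auto simp: S_def)
    then show ?thesis using that by (simp add: at_within_Icc_at S_def)
  qed
  have int: "f integrable_on {x..y}" for x y
    by (intro integrable_continuous_real continuous_on_subset[OF f]) auto
  have v_eq: "integral {x..x + T} f = u (x + T) - u x" if "x \<in> S" for x
    unfolding u_def
    using that T Henstock_Kurzweil_Integration.integral_combine[OF _ _ int, of m x "x + T"]
    by (simp add: S_def algebra_simps)
  have "\<exists>c. \<forall>x\<in>S. u (x + T) - u x = c"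
  proof (rule has_derivative_zero_constant)
    fix x assume x: "x \<in> S"
    then have "x + T \<in> S" using T by (simp add: S_def)
    have "((\<lambda>x. x + T) has_vector_derivative 1) (at x)"
      by (auto intro!: derivative_eq_intros)
    then have "((u \<circ> (\<lambda>x. x + T)) has_vector_derivative 1 *\<^sub>R f (x + T)) (at x)"
      using der[OF \<open>x + T \<in> S\<close>] by (rule vector_diff_chain_at)
    then have "((\<lambda>x. u (x + T) - u x) has_vector_derivative f (x + T) - f x) (at x)"
      using der[OF x] by (intro has_vector_derivative_diff) (simp_all add: o_def)
    then show "((\<lambda>x. u (x + T) - u x) has_derivative (\<lambda>h. 0)) (at x within S)"
      by (simp add: per has_vector_derivative_def has_derivative_at_withinI)
  qed (simp add: S_def)
  then obtain c where "\<And>x. x \<in> S \<Longrightarrow> integral {x..x + T} f = c" using v_eq by metis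
  from this[of a] this[of 0] show ?thesis by (simp add: S_def m_def)
qed

text \<open>Unnormalised: \<open>T\<close> times the usual k-th Fourier coefficient. The exponent
  has the form - z x with z = 2 pi i k / T, to match the period integral at a zero of the
  denominator.\<close>

definition fourier_coeff :: "real \<Rightarrow> (real \<Rightarrow> real) \<Rightarrow> int \<Rightarrow> complex" where
  "fourier_coeff T G k =
     integral {0..T} (\<lambda>x. exp (- (2 * of_real pi * \<i> * of_int k / of_real T) * of_real x) * of_real (G x))"

text \<open>A shift by half a period of the exponential flips its sign.\<close>

lemma fourier_coeff_half_shift:
  fixes G :: "real \<Rightarrow> real"
  assumes G: "continuous_on UNIV G" and per: "\<And>x. G (x + T) = G x" and T: "T > 0"
    and k: "k \<noteq> (0::int)"
  shows "2 * fourier_coeff T G k = integral {0..T} (\<lambda>x.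
    exp (- (2 * of_real pi * \<i> * of_int k / of_real T) * of_real x) * of_real (G x - G (x + T / (2 * of_int k))))"
proof -
  define e where "e = (\<lambda>x::real. exp (- (2 * of_real pi * \<i> * of_int k / of_real T) * of_real x))"
  define a :: real where "a = T / (2 * of_int k)"
  have e_add: "e (x + y) = e x * e y" for x y
    unfolding e_def exp_add[symmetric] of_real_add by (simp only: distrib_left)
  have "e T = exp (2 * of_real pi * \<i> * of_int (- k))"
    using T by (simp add: e_def mult_ac)
  then have eT: "e T = 1" by (simp only: exp_two_pi_int)
  have "e a = exp (- (of_real pi * \<i>))"
    using T k by (simp add: e_def a_def field_simps)
  then have ea: "e a = - 1" by (simp add: exp_minus mult.commute)
  have e_cont: "continuous_on S e" for S unfolding e_def by (intro continuous_intros)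
  have G_cont: "continuous_on S (\<lambda>x. G (x + c))" for S c
    by (intro continuous_on_compose2[OF G] continuous_intros) auto
  have G_cont0: "continuous_on S G" for S using G_cont[of S 0] by simp
  have int: "(\<lambda>x. e x * of_real (G (x + c))) integrable_on {0..T}" for c
    by (intro integrable_continuous_real continuous_intros e_cont G_cont)
  \<comment> \<open>Periodicity moves the window to start at \<open>a\<close>; translating it back
    by \<open>a\<close> negates \<open>e\<close> and leaves the shift in \<open>G\<close>
    only.\<close>
  have "integral {0..T} (\<lambda>x. e x * of_real (G x)) = integral {a..a + T} (\<lambda>x. e x * of_real (G x))"
    by (intro integral_periodic[symmetric] continuous_intros e_cont G_cont0 T)
       (simp add: e_add eT per)
  also have "\<dots> = integral {0..T} ((\<lambda>x. e x * of_real (G x)) \<circ> (\<lambda>x. x + a))"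
    using integral_shift[of 0 a T "\<lambda>x. e x * of_real (G x)"]
    by (simp add: add.commute continuous_intros e_cont G_cont0)
  also have "\<dots> = - integral {0..T} (\<lambda>x. e x * of_real (G (x + a)))"
    by (simp add: o_def e_add ea)
  finally have *: "integral {0..T} (\<lambda>x. e x * of_real (G x)) = - integral {0..T} (\<lambda>x. e x * of_real (G (x + a)))" .
  have "integral {0..T} (\<lambda>x. e x * of_real (G x - G (x + a))) =
      integral {0..T} (\<lambda>x. e x * of_real (G (x + 0)) - e x * of_real (G (x + a)))"
    by (simp add: algebra_simps)
  also have "\<dots> = integral {0..T} (\<lambda>x. e x * of_real (G (x + 0))) - integral {0..T} (\<lambda>x. e x * of_real (G (x + a)))"
    by (intro Henstock_Kurzweil_Integration.integral_diff int)
  also have "\<dots> = 2 * integral {0..T} (\<lambda>x. e x * of_real (G x))"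
    using * by simp
  finally show ?thesis by (simp add: e_def a_def fourier_coeff_def)
qed

text \<open>In the half-shift formula the shift T/(2k) tends to 0, so uniform continuity of
  \<open>G\<close> makes the integrand small.\<close>

lemma riemann_lebesgue_periodic:
  fixes G :: "real \<Rightarrow> real"
  assumes G: "continuous_on UNIV G" and per: "\<And>x. G (x + T) = G x" and T: "T > 0" and \<epsilon>: "\<epsilon> > 0"
  shows "\<exists>n::nat. \<forall>k. \<bar>k\<bar> \<ge> int n \<longrightarrow> norm (fourier_coeff T G k) < \<epsilon>"
proof -
  \<comment> \<open>The interval contains x + a for x in [0,T] and shifts a of either sign with |a|
    \<le> T. The tolerance \<open>\<epsilon> / T\<close> integrates to \<open>\<epsilon>\<close>,
    and the factor 2 of the half-shift formula makes the final inequality strict.\<close>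
  have "uniformly_continuous_on {- T..2 * T} G"
    by (intro compact_uniformly_continuous continuous_on_subset[OF G]) auto
  then obtain d where d: "d > 0" "\<And>x y. x \<in> {- T..2 * T} \<Longrightarrow> y \<in> {- T..2 * T} \<Longrightarrow> dist y x < d \<Longrightarrow>
      dist (G y) (G x) < \<epsilon> / T"
    using \<epsilon> T unfolding uniformly_continuous_on_def by (metis divide_pos_pos)
  obtain n where n: "real n > T / d" using reals_Archimedean2 by blast
  have "0 < T / d" using T d(1) by simp
  then have "0 < real n" using n by (rule less_trans)
  then have n0: "n > 0" by simp
  show ?thesis
  proof (intro exI[of _ n] allI impI)
    fix k :: int assume k: "\<bar>k\<bar> \<ge> int n"
    then have k0: "k \<noteq> 0" using n0 by auto
    define a where "a = T / (2 * of_int k)"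
    have k1: "real n \<le> \<bar>real_of_int k\<bar>" "1 \<le> \<bar>real_of_int k\<bar>" using k n0 by linarith+
    have "T < d * \<bar>real_of_int k\<bar>"
    proof -
      have "T < d * real n" using n d(1) by (simp add: field_simps)
      also have "\<dots> \<le> d * \<bar>real_of_int k\<bar>" using k1(1) d(1) by (intro mult_left_mono) auto
      finally show ?thesis .
    qed
    then have a1: "\<bar>a\<bar> < d" using T k1 d by (simp add: a_def abs_mult field_simps)
    have a2: "\<bar>a\<bar> \<le> T" using T k1 by (simp add: a_def abs_mult field_simps)
    have "norm (2 * fourier_coeff T G k) \<le> \<epsilon> / T * (T - 0)"
      unfolding fourier_coeff_half_shift[OF G per T k0]
    proof (rule integral_bound)
      show "continuous_on {0..T} (\<lambda>x. exp (- (2 * of_real pi * \<i> * of_int k / of_real T) * of_real x) * of_real (G x - G (x + T / (2 * of_int k))))"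
        by (intro continuous_intros continuous_on_subset[OF G] continuous_on_compose2[OF G]) auto
      fix x assume x: "x \<in> {0..T}"
      have "dist (G x) (G (x + a)) < \<epsilon> / T"
        using x a1 a2 by (intro d(2)) (auto simp: dist_real_def)
      then have "\<bar>G x - G (x + a)\<bar> \<le> \<epsilon> / T" by (simp add: dist_real_def)
      then show "norm (exp (- (2 * of_real pi * \<i> * of_int k / of_real T) * of_real x) * of_real (G x - G (x + T / (2 * of_int k)))) \<le> \<epsilon> / T"
        unfolding norm_mult norm_of_real by (simp add: a_def)
    qed (use T in auto)
    then have "2 * norm (fourier_coeff T G k) \<le> \<epsilon>" using T by (simp add: norm_mult)
    then show "norm (fourier_coeff T G k) < \<epsilon>" using \<epsilon> by linarith
  qed
qed

text \<open>At these frequencies the exponential also has period \<open>T\<close>, so any period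
  gives the same integral. This is what frees the residues from the choice of the cutoff.\<close>

lemma integral_period_eq_fourier_coeff:
  assumes G: "continuous_on UNIV G" and per: "\<And>x. G (x + T) = G x" and T: "T > 0"
  shows "integral {a..a + T} (\<lambda>x. exp (- (2 * of_real pi * \<i> * of_int k / of_real T) * of_real x) * of_real (G x))
    = fourier_coeff T G k"
  unfolding fourier_coeff_def
proof (rule integral_periodic[OF _ _ T])
  let ?z = "- (2 * of_real pi * \<i> * of_int k / of_real T) :: complex"
  fix x
  have "exp (?z * of_real T) = exp (2 * of_real pi * \<i> * of_int (- k))"
    using T by (simp add: mult_ac)
  also have "\<dots> = 1" by (simp only: exp_two_pi_int)
  finally show "exp (?z * of_real (x + T)) * of_real (G (x + T)) = exp (?z * of_real x) * of_real (G x)"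
    by (simp only: of_real_add distrib_left exp_add per) simp
qed (intro continuous_intros G)

section \<open>Mellin transform of a log-periodic function\<close>

lemma set_lebesgue_integral_open_interval:
  fixes f :: "real \<Rightarrow> 'a::euclidean_space"
  assumes f: "continuous_on {a..b} f"
  shows "(LINT t:{a..<b}|lborel. f t) = integral {a..b} f"
proof -
  have "set_integrable lborel {a..b} f"
    by (rule borel_integrable_atLeastAtMost'[OF f])
  then have "set_integrable lborel {a..<b} f" by (rule set_integrable_subset) auto
  then have "(LINT t:{a..<b}|lborel. f t) = integral {a..<b} f"
    by (rule set_borel_integral_eq_integral(2))
  also have "\<dots> = integral {a..b} f"
    by (rule integral_spike_set; rule negligible_subset[of "{b}"]) auto
  finally show ?thesis .
qed

text \<open>Under \<open>t = exp (- x)\<close> the scaling of \<open>t\<close> by \<open>exp (- T)\<close> is the translation of \<open>x\<close> by the period,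
  which turns the Mellin transform into a geometric series.\<close>

lemma mellin_log_periodic:
  fixes G :: "real \<Rightarrow> real"
  assumes G: "continuous_on UNIV G" and per: "\<And>x. G (x + T) = G x" and T: "T > 0"
    and M: "\<And>x. \<bar>G x\<bar> \<le> M" and b: "b > 0" and z: "Re z > 0"
  shows "(1 - exp (- of_real T * z)) *
      (LINT t:{0<..<b}|lborel. of_real t powr (z - 1) * of_real (G (ln (1 / t)))) =
    integral {- ln b..- ln b + T} (\<lambda>x. exp (- z * of_real x) * of_real (G x))"
proof -
  define q where "q = exp (- T)"
  have q: "0 < q" "q < 1" using T by (auto simp: q_def)
  define f where "f = (\<lambda>t. exp ((z - 1) * of_real (ln t)) * of_real (G (- ln t)))"
  define I where "I = (LINT t:{0<..<b}|lborel. f t)"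
  have [measurable]: "G \<in> borel_measurable borel"
    by (rule borel_measurable_continuous_onI[OF G])
  have h: "(\<lambda>t. G (ln (1 / t))) \<in> borel_measurable borel" by measurable
  have bd: "\<bar>G (ln (1 / t))\<bar> \<le> M * t powr (- 0)" if "0 < t" for t
    using M[of "ln (1 / t)"] that by simp
  have f_eq: "f t = exp ((z - 1) * of_real (ln t)) * of_real (G (ln (1 / t)))" if "t > 0" for t
    using that by (simp add: f_def ln_div)
  have I: "(LINT t:{0<..<b}|lborel. of_real t powr (z - 1) * of_real (G (ln (1 / t)))) = I"
    unfolding I_def
    by (intro set_lebesgue_integral_cong) (auto simp: of_real_powr_eq_exp f_eq)
  have int: "set_integrable lborel {0<..<b} f"
  proof -
    have "set_integrable lborel {0<..<b} (\<lambda>t. of_real t powr (z - 1) * of_real (G (ln (1 / t))))"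
      by (rule mellin_integrable[OF h bd]) (use z in auto)
    then show ?thesis
      by (subst (asm) set_integrable_cong[where f' = f]) (auto simp: of_real_powr_eq_exp f_eq)
  qed
  have qb: "0 < q * b" "q * b < b" using q b by auto
  have split: "{0<..<b} = {0<..<q * b} \<union> {q * b..<b}" using qb by auto
  have "I = (LINT t:{0<..<q * b}|lborel. f t) + (LINT t:{q * b..<b}|lborel. f t)"
    unfolding I_def split
  proof (rule set_integral_Un)
    show "set_integrable lborel {0<..<q * b} f" "set_integrable lborel {q * b..<b} f"
      using qb by (auto intro!: set_integrable_subset[OF int])
  qed auto
  \<comment> \<open>Replacing t by q t reproduces the integral over (0,b): \<open>f\<close>
    contributes exp(-T(z-1)) and dt contributes q = exp(-T).\<close>
  also have "(LINT t:{0<..<q * b}|lborel. f t) = exp (- of_real T * z) * I"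
  proof -
    have "(LINT t:{0<..<q * b}|lborel. f t) =
        q *\<^sub>R (LINT t|lborel. indicat_real {0<..<q * b} (q * t) *\<^sub>R f (q * t))"
      unfolding set_lebesgue_integral_def
      using lborel_integral_real_affine[of q "\<lambda>t. indicat_real {0<..<q * b} t *\<^sub>R f t" 0] q by simp
    also have "(LINT t|lborel. indicat_real {0<..<q * b} (q * t) *\<^sub>R f (q * t)) =
        (LINT t|lborel. exp (- of_real T * (z - 1)) * (indicat_real {0<..<b} t *\<^sub>R f t))"
    proof (rule Bochner_Integration.integral_cong)
      fix t
      show "indicat_real {0<..<q * b} (q * t) *\<^sub>R f (q * t) =
          exp (- of_real T * (z - 1)) * (indicat_real {0<..<b} t *\<^sub>R f t)"
      proof (cases "t \<in> {0<..<b}")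
        case True
        then have t: "0 < t" by simp
        have ln: "ln (q * t) = ln t - T" using q t by (simp add: ln_mult q_def)
        have "exp ((z - 1) * of_real (ln t - T)) = exp (- of_real T * (z - 1)) * exp ((z - 1) * of_real (ln t))"
          unfolding exp_add[symmetric] by (simp add: algebra_simps)
        moreover have "G (- (ln t - T)) = G (- ln t)" using per[of "- ln t"] by simp
        ultimately show ?thesis using True q by (simp add: f_def ln)
      next
        case False
        then have "q * t \<notin> {0<..<q * b}" using q by (auto simp: zero_less_mult_iff)
        with False show ?thesis by simp
      qed
    qed simp
    also have "\<dots> = exp (- of_real T * (z - 1)) * I"
      by (simp only: I_def set_lebesgue_integral_def integral_mult_right_zero)
    also have "q *\<^sub>R \<dots> = (exp (- of_real T) * exp (- of_real T * (z - 1))) * I"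
      by (simp only: q_def scaleR_conv_of_real exp_of_real[symmetric] of_real_minus mult.assoc)
    also have "exp (- of_real T) * exp (- of_real T * (z - 1)) = exp (- of_real T * z)"
      unfolding exp_add[symmetric] by (simp add: algebra_simps)
    finally show ?thesis .
  qed
  \<comment> \<open>This piece is exactly one period in the logarithmic variable. The change t =
    exp(-x) is done as t = exp x followed by the reflection x to -x.\<close>
  also have "(LINT t:{q * b..<b}|lborel. f t) =
      integral {- ln b..- ln b + T} (\<lambda>x. exp (- z * of_real x) * of_real (G x))"
  proof -
    have cont: "continuous_on {q * b..b} f"
      unfolding f_def using qb
      by (intro continuous_intros continuous_on_compose2[OF G]) auto
    have e: "exp (ln b - T) = q * b" "exp (ln b) = b"
      using b by (simp_all add: q_def exp_diff exp_minus field_simps)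
    have "((\<lambda>x. exp x *\<^sub>R f (exp x)) has_integral (integral {exp (ln b - T)..exp (ln b)} f)) {ln b - T..ln b}"
    proof (rule has_integral_substitution)
      have "exp ` {ln b - T..ln b} \<subseteq> {exp (ln b - T)..exp (ln b)}" by auto
      then show "exp ` {ln b - T..ln b} \<subseteq> {q * b..b}" unfolding e .
      show "(exp has_real_derivative exp x) (at x within {ln b - T..ln b})" for x
        by (rule has_field_derivative_at_within[OF DERIV_exp])
    qed (use T cont in auto)
    moreover have "exp x *\<^sub>R f (exp x) = exp (- z * of_real (- x)) * of_real (G (- x))" for x
    proof -
      have "exp x *\<^sub>R f (exp x) = (exp (of_real x) * exp ((z - 1) * of_real x)) * of_real (G (- x))"
        by (simp only: f_def scaleR_conv_of_real exp_of_real[symmetric] ln_exp mult.assoc)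
      also have "exp (of_real x) * exp ((z - 1) * of_real x) = exp (- z * of_real (- x))"
        unfolding exp_add[symmetric] by (simp add: algebra_simps)
      finally show ?thesis .
    qed
    ultimately have "((\<lambda>x. exp (- z * of_real (- x)) * of_real (G (- x))) has_integral (integral {q * b..b} f)) {ln b - T..ln b}"
      by (simp only: e)
    then have "integral {ln b - T..ln b} (\<lambda>x. exp (- z * of_real (- x)) * of_real (G (- x))) =
        integral {q * b..b} f"
      by (rule integral_unique)
    moreover have "integral {ln b - T..ln b} (\<lambda>x. exp (- z * of_real (- x)) * of_real (G (- x))) =
       integral {- ln b..- ln b + T} (\<lambda>x. exp (- z * of_real x) * of_real (G x))"
    proof -
      have "integral {- (- ln b + T)..- (- ln b)} (\<lambda>x. F (- x)) = integral {- ln b..- ln b + T} F"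
        for F :: "real \<Rightarrow> complex" by (rule Henstock_Kurzweil_Integration.integral_reflect_real)
      from this[of "\<lambda>x. exp (- z * of_real x) * of_real (G x)"] show ?thesis
        by (simp only: minus_add_distrib minus_minus diff_conv_add_uminus)
    qed
    ultimately show ?thesis
      using set_lebesgue_integral_open_interval[OF cont] by (simp only:)
  qed
  finally have "I - exp (- of_real T * z) * I =
      integral {- ln b..- ln b + T} (\<lambda>x. exp (- z * of_real x) * of_real (G x))"
    unfolding diff_eq_eq by (simp only: add.commute)
  then show ?thesis unfolding I by (simp only: left_diff_distrib mult_1_left)
qed

section \<open>Meromorphic functions\<close>

text \<open>A zero of f cancels the simple zero of g: the quotient then has a finite limit and
  residue 0, which f z / g' also yields. The residue formula thus needs no case distinction.\<close>

lemma simple_quotient_at_zero: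
  fixes f g :: "complex \<Rightarrow> complex"
  assumes f: "f holomorphic_on S" and g: "g holomorphic_on S" and S: "open S" "connected S" "z \<in> S"
    and g': "(g has_field_derivative g') (at z)" "g z = 0" "g' \<noteq> 0"
  shows "is_pole (\<lambda>w. f w / g w) z \<longleftrightarrow> f z \<noteq> 0"
    and "f z \<noteq> 0 \<Longrightarrow> zorder (\<lambda>w. f w / g w) z = - 1"
    and "residue (\<lambda>w. f w / g w) z = f z / g'"
proof -
  have g0: "\<forall>\<^sub>F w in at z. g w \<noteq> 0"
  proof -
    have "((\<lambda>w. g w / (w - z)) \<longlongrightarrow> g') (at z)"
      using has_field_derivativeD[OF g'(1)] g'(2) by simp
    then have "\<forall>\<^sub>F w in at z. g w / (w - z) \<noteq> 0"
      using g'(3) by (rule tendsto_imp_eventually_ne)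
    then show ?thesis by eventually_elim auto
  qed
  have pole: "is_pole (\<lambda>w. f w / g w) z" if "f z \<noteq> 0"
  proof (rule is_pole_divide)
    show "isCont f z"
      using f S by (meson analytic_at_imp_isCont holomorphic_on_imp_analytic_at)
    show "filterlim g (at 0) (at z)"
      using g0 g' DERIV_isCont[OF g'(1)] by (auto simp: filterlim_at isCont_def)
  qed fact
  have lim: "((\<lambda>w. f w / g w) \<longlongrightarrow> deriv f z / g') (at z)" if "f z = 0"
    using holomorphic_derivI[OF f S(1,3)] g' that
    by (intro lhopital_complex_simple) auto
  show "is_pole (\<lambda>w. f w / g w) z \<longleftrightarrow> f z \<noteq> 0"
    using pole lim not_tendsto_and_filterlim_at_infinity[of "at z"] by (auto simp: is_pole_def)
  show "zorder (\<lambda>w. f w / g w) z = - 1" if "f z \<noteq> 0"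
    using porder_simple_pole_deriv[OF f g S g'(1) that g'(2,3)] .
  show "residue (\<lambda>w. f w / g w) z = f z / g'"
  proof (cases "f z = 0")
    case False
    then show ?thesis using residue_simple_pole_deriv[OF f g S g'(1) False g'(2,3)] by simp
  next
    case True
    \<comment> \<open>The singularity is removable here; its residue is read off from the filled-in
      function, which is holomorphic near z.\<close>
    have "f analytic_on {z}" "g analytic_on {z}"
      using f g S by (auto intro: holomorphic_on_imp_analytic_at)
    then have "(\<lambda>w. f w / g w) meromorphic_on {z}"
      by (intro meromorphic_intros) (auto intro: analytic_on_imp_meromorphic_on)
    then have iso: "isolated_singularity_at (\<lambda>w. f w / g w) z"
      by (rule meromorphic_on_isolated_singularity)
    from remove_sings_analytic_at[OF this lim[OF True]]
    obtain U where "open U" "z \<in> U" "remove_sings (\<lambda>w. f w / g w) holomorphic_on U"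
      by (auto simp: analytic_at)
    then have "residue (remove_sings (\<lambda>w. f w / g w)) z = 0" by (intro residue_holo)
    then show ?thesis using True iso by simp
  qed
qed

text \<open>The identity theorem for the difference gives equality on punctured neighbourhoods only.
  At the point itself the normalisation decides: both values are 0 at a common pole and the common
  limit otherwise.\<close>

lemma nicely_meromorphic_on_unique:
  assumes f: "f nicely_meromorphic_on V" and g: "g nicely_meromorphic_on V"
    and V: "open V" "connected V" and U: "open U" "U \<noteq> {}" "U \<subseteq> V"
    and eq: "\<And>s. s \<in> U \<Longrightarrow> f s = g s" and z: "z \<in> V"
  shows "f z = g z"
proof -
  have "(\<lambda>s. f s - g s) meromorphic_on V"
    using f g by (intro meromorphic_intros) (auto simp: nicely_meromorphic_on_def)
  from meromorphic_imp_constant_or_avoid[OF this V, of 0]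
  have ev: "\<forall>\<^sub>F s in at z. f s = g s"
  proof
    assume "\<forall>\<^sub>\<approx>s\<in>V. f s - g s = 0"
    then show ?thesis using z V by (auto simp: eventually_cosparse_open_eq)
  next
    assume *: "\<forall>\<^sub>\<approx>s\<in>V. f s - g s \<noteq> 0"
    obtain u where u: "u \<in> U" using U by blast
    then have "\<forall>\<^sub>F s in at u. f s - g s \<noteq> 0"
      using * U V by (auto simp: eventually_cosparse_open_eq)
    moreover have "\<forall>\<^sub>F s in at u. s \<in> U" using U u by (simp add: eventually_at_in_open')
    ultimately have "\<forall>\<^sub>F s in at u. False" by eventually_elim (use eq in auto)
    then show ?thesis by simp
  qed
  then have pole: "is_pole f z \<longleftrightarrow> is_pole g z" by (intro is_pole_cong) auto
  have f': "is_pole f z \<and> f z = 0 \<or> f \<midarrow>z\<rightarrow> f z" and g': "is_pole g z \<and> g z = 0 \<or> g \<midarrow>z\<rightarrow> g z"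
    using f g z by (auto simp: nicely_meromorphic_on_def)
  show ?thesis
  proof (cases "is_pole f z")
    case True
    moreover have "\<not> h \<midarrow>z\<rightarrow> c" if "is_pole h z" for h :: "complex \<Rightarrow> complex" and c
      using not_tendsto_and_filterlim_at_infinity[of "at z"] that by (auto simp: is_pole_def)
    ultimately show ?thesis using pole f' g' by auto
  next
    case False
    then have "f \<midarrow>z\<rightarrow> f z" "g \<midarrow>z\<rightarrow> g z" using pole f' g' by auto
    moreover have "f \<midarrow>z\<rightarrow> g z" using \<open>g \<midarrow>z\<rightarrow> g z\<close> ev by (simp add: tendsto_cong)
    ultimately show ?thesis using LIM_unique by blast
  qed
qed

lemma half_plane_ereal: "half_plane (ereal a) = {s. Re s > a}"
  by (simp add: half_plane_def)

lemma open_half_plane_Re: "open {s. Re s > a}" "connected {s. Re s > a}"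
  using open_halfspace_Re_gt convex_connected[OF convex_halfspace_Re_gt] by auto


section \<open>Log-periodic tube asymptotics\<close>

text \<open>Serves to turn the value of \<open>G\<close> at one point, reached in the limit along
  translates by the period, into a bound on a Minkowski content.\<close>

lemma Liminf_le_Limsup_ge_of_seq:
  fixes g :: "'a \<Rightarrow> ereal"
  assumes u: "filterlim u F sequentially" and lim: "(\<lambda>n. g (u n)) \<longlonglongrightarrow> l"
  shows "Liminf F g \<le> l" "l \<le> Limsup F g"
proof -
  show "Liminf F g \<le> l"
  proof (rule dense_ge)
    fix y assume "l < y"
    show "Liminf F g \<le> y"
    proof (rule ccontr)
      assume "\<not> Liminf F g \<le> y"
      then have "\<forall>\<^sub>F x in F. y < g x" by (auto intro: less_LiminfD)
      then have "\<forall>\<^sub>F n in sequentially. y < g (u n)" using u by (rule eventually_compose_filterlim)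
      then have "y \<le> l"
        by (intro tendsto_lowerbound[OF lim]) (auto elim: eventually_mono)
      with \<open>l < y\<close> show False by simp
    qed
  qed
  show "l \<le> Limsup F g"
  proof (rule dense_le)
    fix y assume "y < l"
    show "y \<le> Limsup F g"
    proof (rule ccontr)
      assume "\<not> y \<le> Limsup F g"
      then have "\<forall>\<^sub>F x in F. g x < y" by (auto intro: Limsup_lessD)
      then have "\<forall>\<^sub>F n in sequentially. g (u n) < y" using u by (rule eventually_compose_filterlim)
      then have "l \<le> y"
        by (intro tendsto_upperbound[OF lim]) (auto elim: eventually_mono)
      with \<open>y < l\<close> show False by simp
    qed
  qed
qed

lemma Inf_ereal_greaterThan: "Inf (ereal ` {a<..}) = ereal a"
proof (rule antisym)
  show "ereal a \<le> Inf (ereal ` {a<..})" by (intro Inf_greatest) auto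
  show "Inf (ereal ` {a<..}) \<le> ereal a"
  proof (rule dense_ge)
    fix y assume "ereal a < y"
    then obtain r where "ereal r < y" "a < r" using ereal_dense2 by force
    then show "Inf (ereal ` {a<..}) \<le> y" by (auto intro: Inf_lower2)
  qed
qed

lemma filterlim_exp_minus_at_right_0: "filterlim (\<lambda>x::real. exp (- x)) (at_right 0) at_top"
proof -
  have "((\<lambda>x::real. exp (- x)) \<longlongrightarrow> 0) at_top"
    using filterlim_compose[OF exp_at_bot filterlim_uminus_at_bot_at_top] .
  then show ?thesis by (auto simp: filterlim_at)
qed

text \<open>The big-O hypothesis is unpacked into an explicit constant \<open>C\<close> on an
  explicit interval below \<open>t0\<close>, and divided by t^(N-D); later estimates need both
  numbers.\<close>

locale log_periodic_tube =
  fixes A :: "'a::euclidean_space set" and D \<alpha> T C t0 :: real and G :: "real \<Rightarrow> real"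
  assumes A: "bounded A" "A \<noteq> {}"
    and D_nonneg: "D \<ge> 0" and alpha_pos: "\<alpha> > 0" and T_pos: "T > 0" and t0_pos: "t0 > 0"
    and G_nonneg: "G x \<ge> 0" and G_periodic: "G (x + T) = G x"
    and G_nonconst: "\<not> G constant_on UNIV"
    and rel_vol_bound: "0 < t \<Longrightarrow> t < t0 \<Longrightarrow>
      \<bar>tube_vol A t / t powr (real DIM('a) - D) - G (ln (1 / t))\<bar> \<le> C * t powr \<alpha>"
begin

section \<open>The relative tube volume and its periodic profile\<close>

definition rel_vol :: "real \<Rightarrow> real" where
  "rel_vol t = tube_vol A t / t powr (real DIM('a) - D)"

lemma C_nonneg: "C \<ge> 0"
proof -
  have "0 \<le> C * (t0/2) powr \<alpha>"
    by (rule order.trans[OF abs_ge_zero rel_vol_bound[of "t0/2"]]) (use t0_pos in auto)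
  moreover have "(t0/2) powr \<alpha> > 0" using t0_pos by simp
  ultimately show ?thesis by (simp add: zero_le_mult_iff)
qed

lemma rel_vol_exp_bound:
  assumes "x > - ln t0"
  shows "\<bar>rel_vol (exp (- x)) - G x\<bar> \<le> C * exp (- \<alpha> * x)"
proof -
  have "exp (- x) < exp (ln t0)" using assms by (subst exp_less_cancel_iff) simp
  then have "exp (- x) < t0" using t0_pos by simp
  then show ?thesis
    using rel_vol_bound[of "exp (- x)"] by (simp add: rel_vol_def powr_def ln_div)
qed

lemma G_periodic_int: "G (x + of_int k * T) = G x"
proof -
  interpret periodic_fun_simple G T by unfold_locales (rule G_periodic)
  show ?thesis by (rule plus_of_int)
qed

lemma G_periodic_nat: "G (x + real n * T) = G x"
  using G_periodic_int[of x "int n"] by simp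

lemma ex_period_translate: "\<exists>k. x + of_int k * T \<in> {0..T}"
proof
  show "x + of_int (- \<lfloor>x / T\<rfloor>) * T \<in> {0..T}"
    using T_pos floor_divide_lower[OF T_pos, of x] floor_divide_upper[OF T_pos, of x]
    by (simp add: algebra_simps)
qed

lemma filterlim_translates: "filterlim (\<lambda>n. x + real n * T) at_top sequentially"
  using T_pos
  by (intro filterlim_tendsto_add_at_top[OF tendsto_const]
      filterlim_at_top_mult_tendsto_pos[OF tendsto_const] filterlim_real_sequentially)

lemma error_tendsto_0: "((\<lambda>x. C * exp (- \<alpha> * x)) \<longlongrightarrow> 0) at_top"
proof -
  have "filterlim (\<lambda>x. - (\<alpha> * x)) at_bot at_top"
    using alpha_pos
    by (intro filterlim_compose[OF filterlim_uminus_at_bot_at_top]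
        filterlim_tendsto_pos_mult_at_top[OF tendsto_const] filterlim_ident)
  from filterlim_compose[OF exp_at_bot this] have "((\<lambda>x. exp (- \<alpha> * x)) \<longlongrightarrow> 0) at_top"
    by simp
  from tendsto_mult_right_zero[OF this] show ?thesis .
qed

lemma rel_vol_exp_minus_G: "((\<lambda>x. rel_vol (exp (- x)) - G x) \<longlongrightarrow> 0) at_top"
proof (rule Lim_null_comparison[OF _ error_tendsto_0])
  show "\<forall>\<^sub>F x in at_top. norm (rel_vol (exp (- x)) - G x) \<le> C * exp (- \<alpha> * x)"
    using eventually_gt_at_top[of "- ln t0"]
    by eventually_elim (use rel_vol_exp_bound in auto)
qed

lemma rel_vol_minus_G: "((\<lambda>t. rel_vol t - G (ln (1 / t))) \<longlongrightarrow> 0) (at_right 0)"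
proof -
  have "filterlim (\<lambda>t::real. - ln t) at_top (at_right 0)"
    using ln_at_0 by (simp add: filterlim_uminus_at_top)
  from filterlim_compose[OF rel_vol_exp_minus_G this]
  have "((\<lambda>t. rel_vol (exp (ln t)) - G (- ln t)) \<longlongrightarrow> 0) (at_right 0)" by simp
  then show ?thesis
    by (rule Lim_transform_eventually)
       (auto simp: eventually_at_filter ln_div)
qed

lemma rel_vol_translates: "(\<lambda>n. rel_vol (exp (- (x + real n * T)))) \<longlonglongrightarrow> G x"
proof -
  from filterlim_compose[OF rel_vol_exp_minus_G filterlim_translates[of x]]
  have "(\<lambda>n. rel_vol (exp (- (x + real n * T))) - G x) \<longlonglongrightarrow> 0"
    by (simp add: G_periodic_nat)
  then show ?thesis by (simp add: LIM_zero_iff)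
qed

lemma continuous_on_G: "continuous_on UNIV G"
proof -
  \<comment> \<open>Uniformity needs a left end: the error bound decreases in x, so on this
    half-line it is worst at \<open>a\<close>, and one n with a + nT > - ln t0 serves all x.\<close>
  have "continuous_on {a<..} G" for a
  proof (rule uniform_limit_theorem[of _ "\<lambda>n x. rel_vol (exp (- (x + real n * T)))" sequentially])
    show "uniform_limit {a<..} (\<lambda>n x. rel_vol (exp (- (x + real n * T)))) G sequentially"
    proof (rule uniform_limitI)
      fix e :: real assume "e > 0"
      then have "\<forall>\<^sub>F n in sequentially. C * exp (- \<alpha> * (a + real n * T)) < e"
        by (rule order_tendstoD(2)[OF filterlim_compose[OF error_tendsto_0 filterlim_translates]])
      moreover have "\<forall>\<^sub>F n in sequentially. a + real n * T > - ln t0"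
        using filterlim_translates unfolding filterlim_at_top_dense by blast
      ultimately show "\<forall>\<^sub>F n in sequentially. \<forall>x\<in>{a<..}. dist (rel_vol (exp (- (x + real n * T)))) (G x) < e"
      proof eventually_elim
        case (elim n)
        show ?case
        proof
          fix x assume x: "x \<in> {a<..}"
          have "\<bar>rel_vol (exp (- (x + real n * T))) - G x\<bar> \<le> C * exp (- \<alpha> * (x + real n * T))"
            using rel_vol_exp_bound[of "x + real n * T"] x elim by (simp add: G_periodic_nat)
          also have "\<dots> \<le> C * exp (- \<alpha> * (a + real n * T))"
            using x alpha_pos C_nonneg by (intro mult_left_mono) auto
          finally show "dist (rel_vol (exp (- (x + real n * T)))) (G x) < e"
            using elim by (simp add: dist_real_def)
        qed
      qed
    qed
    show "\<forall>\<^sub>F n in sequentially. continuous_on {a<..} (\<lambda>x. rel_vol (exp (- (x + real n * T))))"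
      unfolding rel_vol_def
      by (intro always_eventually allI continuous_intros
          continuous_on_compose2[OF continuous_on_tube_vol[OF A]]) auto
  qed simp
  then have "continuous_on (\<Union>a. {a<..}) G"
    by (intro continuous_on_open_UN) auto
  moreover have "(\<Union>a::real. {a<..}) = UNIV" by (auto intro: lt_ex)
  ultimately show ?thesis by simp
qed

text \<open>The limiting form of the monotonicity of the tube volume.\<close>

lemma G_growth:
  assumes "u \<ge> 0"
  shows "G (x + u) \<le> exp ((real DIM('a) - D) * u) * G x"
proof (rule LIMSEQ_le[OF rel_vol_translates tendsto_mult[OF tendsto_const rel_vol_translates]])
  let ?N = "real DIM('a)"
  have "rel_vol (exp (- (x + u + real n * T))) \<le> exp ((?N - D) * u) * rel_vol (exp (- (x + real n * T)))" for n
  proof -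
    let ?y = "x + real n * T"
    have 1: "rel_vol (exp (- y)) = tube_vol A (exp (- y)) * exp ((?N - D) * y)" for y
      by (simp add: rel_vol_def powr_def exp_minus divide_inverse ln_inverse)
    have "tube_vol A (exp (- (?y + u))) \<le> tube_vol A (exp (- ?y))"
      using assms by (intro tube_vol_mono A) simp
    then have "tube_vol A (exp (- (?y + u))) * exp ((?N - D) * (?y + u))
        \<le> tube_vol A (exp (- ?y)) * exp ((?N - D) * (?y + u))"
      by (intro mult_right_mono) auto
    also have "exp ((?N - D) * (?y + u)) = exp ((?N - D) * u) * exp ((?N - D) * ?y)"
      by (simp add: algebra_simps flip: exp_add)
    finally show ?thesis unfolding 1 by (simp add: algebra_simps flip: exp_add)
  qed
  then show "\<exists>N. \<forall>n\<ge>N. rel_vol (exp (- (x + u + real n * T)))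
       \<le> exp ((?N - D) * u) * rel_vol (exp (- (x + real n * T)))" by blast
qed

lemma G_pos: "G x > 0"
proof (rule ccontr)
  assume "\<not> G x > 0"
  then have x: "G x = 0" using G_nonneg[of x] by simp
  have "G y = 0" for y
  proof -
    \<comment> \<open>The growth estimate only looks forward, so y is replaced by a translate lying
      at or after the zero x.\<close>
    obtain k where "y - x + of_int k * T \<in> {0..T}" using ex_period_translate by blast
    then have "G (x + (y - x + of_int k * T)) \<le> 0"
      using G_growth[of "y - x + of_int k * T" x] x by simp
    then show ?thesis using G_periodic_int[of y k] G_nonneg[of y] by simp
  qed
  then show False using G_nonconst by (auto simp: constant_on_def)
qed

lemma range_G: "range G = G ` {0..T}"
proof -
  have "G x \<in> G ` {0..T}" for x
    using ex_period_translate[of x] G_periodic_int[of x] by (metis image_eqI)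
  then show ?thesis by auto
qed

lemma attains_min: "\<exists>m. \<forall>x. G m \<le> G x"
proof -
  have "\<exists>m\<in>{0..T}. \<forall>y\<in>{0..T}. G m \<le> G y"
    using T_pos continuous_on_subset[OF continuous_on_G]
    by (intro continuous_attains_inf) auto
  then obtain m where "\<forall>y\<in>G ` {0..T}. G m \<le> y" by blast
  then show ?thesis by (metis range_G rangeI)
qed

lemma attains_max: "\<exists>m. \<forall>x. G x \<le> G m"
proof -
  have "\<exists>m\<in>{0..T}. \<forall>y\<in>{0..T}. G y \<le> G m"
    using T_pos continuous_on_subset[OF continuous_on_G]
    by (intro continuous_attains_sup) auto
  then obtain m where "\<forall>y\<in>G ` {0..T}. y \<le> G m" by blast
  then show ?thesis by (metis range_G rangeI)
qed

text \<open>Extremal points are fixed by choice so that the minimum and maximum of \<open>G\<close>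
  are available as terms; their existence is compactness of one period.\<close>

definition argmin where "argmin = (SOME m. \<forall>x. G m \<le> G x)"
definition argmax where "argmax = (SOME m. \<forall>x. G x \<le> G m)"

lemma G_min: "G argmin \<le> G x"
  unfolding argmin_def using someI_ex[OF attains_min] by blast

lemma G_max: "G x \<le> G argmax"
  unfolding argmax_def using someI_ex[OF attains_max] by blast

lemma G_min_less_max: "G argmin < G argmax"
proof (rule ccontr)
  assume "\<not> G argmin < G argmax"
  then have "G x = G argmin" for x using G_min[of x] G_max[of x] by linarith
  then show False using G_nonconst by (auto simp: constant_on_def)
qed

lemma image_G: "G ` {0..T} = {G argmin..G argmax}"
proof -
  have "connected (range G)"
    by (intro connected_continuous_image continuous_on_G) simp
  then have "{G argmin..G argmax} \<subseteq> range G"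
    by (rule connected_contains_Icc) auto
  moreover have "range G \<subseteq> {G argmin..G argmax}" using G_min G_max by auto
  ultimately show ?thesis by (metis range_G subset_antisym)
qed

section \<open>Minkowski contents and dimension\<close>

lemma translates_at_right_0: "filterlim (\<lambda>n. exp (- (x + real n * T))) (at_right 0) sequentially"
  by (rule filterlim_compose[OF filterlim_exp_minus_at_right_0 filterlim_translates])

lemma rel_vol_eventually_bounds:
  assumes "e > 0"
  shows "\<forall>\<^sub>F t in at_right 0. G argmin - e < rel_vol t \<and> rel_vol t < G argmax + e"
proof -
  have "\<forall>\<^sub>F t in at_right 0. - e < rel_vol t - G (ln (1 / t))"
       "\<forall>\<^sub>F t in at_right 0. rel_vol t - G (ln (1 / t)) < e"
    using order_tendstoD[OF rel_vol_minus_G] assms by auto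
  then show ?thesis
    by eventually_elim (smt (verit) G_min G_max)
qed

text \<open>Along t = exp(-(argmin + nT)) the relative volume tends to the minimum, which caps the
  liminf; the uniform eventual bounds give the other inequality.\<close>

lemma lower_content_eq: "lower_content D A = ereal (G argmin)"
proof (rule antisym)
  have "(\<lambda>n. ereal (rel_vol (exp (- (argmin + real n * T))))) \<longlonglongrightarrow> ereal (G argmin)"
    by (intro tendsto_ereal rel_vol_translates)
  from Liminf_le_Limsup_ge_of_seq(1)[OF translates_at_right_0 this]
  show "lower_content D A \<le> ereal (G argmin)"
    by (simp add: lower_content_def rel_vol_def)
  show "ereal (G argmin) \<le> lower_content D A"
    unfolding lower_content_def le_Liminf_iff
  proof safe
    fix y assume y: "y < ereal (G argmin)"
    then obtain r where r: "y < ereal r" "r < G argmin" using ereal_dense2 by force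
    show "\<forall>\<^sub>F t in at_right 0. y < ereal (tube_vol A t / t powr (real DIM('a) - D))"
      using rel_vol_eventually_bounds[of "G argmin - r"]
    proof (rule eventually_mono)
      show "0 < G argmin - r" using r by simp
      fix t assume "G argmin - (G argmin - r) < rel_vol t \<and> rel_vol t < G argmax + (G argmin - r)"
      then show "y < ereal (tube_vol A t / t powr (real DIM('a) - D))"
        using r by (auto simp: rel_vol_def intro: less_trans)
    qed
  qed
qed

lemma upper_content_eq: "upper_content D A = ereal (G argmax)"
proof (rule antisym)
  have "(\<lambda>n. ereal (rel_vol (exp (- (argmax + real n * T))))) \<longlonglongrightarrow> ereal (G argmax)"
    by (intro tendsto_ereal rel_vol_translates)
  from Liminf_le_Limsup_ge_of_seq(2)[OF translates_at_right_0 this]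
  show "ereal (G argmax) \<le> upper_content D A"
    by (simp add: upper_content_def rel_vol_def)
  show "upper_content D A \<le> ereal (G argmax)"
    unfolding upper_content_def Limsup_le_iff
  proof safe
    fix y assume y: "y > ereal (G argmax)"
    then obtain r where r: "y > ereal r" "r > G argmax" using ereal_dense2 by force
    show "\<forall>\<^sub>F t in at_right 0. y > ereal (tube_vol A t / t powr (real DIM('a) - D))"
      using rel_vol_eventually_bounds[of "r - G argmax"]
    proof (rule eventually_mono)
      show "0 < r - G argmax" using r by simp
      fix t assume "G argmin - (r - G argmax) < rel_vol t \<and> rel_vol t < G argmax + (r - G argmax)"
      then show "y > ereal (tube_vol A t / t powr (real DIM('a) - D))"
        using r by (auto simp: rel_vol_def intro: less_trans[of _ "ereal r"])
    qed
  qed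
qed

lemma tube_vol_div_powr:
  assumes "t > 0"
  shows "tube_vol A t / t powr (real DIM('a) - r) = rel_vol t * t powr (r - D)"
  using assms by (simp add: rel_vol_def powr_diff field_simps)

text \<open>Near 0 the relative volume is bounded, so the extra factor t^(r-D) forces the quotient
  to 0.\<close>

lemma content_above:
  assumes "r > D"
  shows "upper_content r A = 0" "lower_content r A = 0"
proof -
  have 0: "((\<lambda>t. (G argmax + 1) * t powr (r - D)) \<longlongrightarrow> 0) (at_right 0)"
    using assms by (auto intro!: tendsto_mult_right_zero tendsto_eq_intros simp: eventually_at_filter)
  have "\<forall>\<^sub>F t in at_right 0. norm (tube_vol A t / t powr (real DIM('a) - r)) \<le> (G argmax + 1) * t powr (r - D)"
    using rel_vol_eventually_bounds[OF zero_less_one] eventually_at_right_less[of "0::real"]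
  proof eventually_elim
    case (elim t)
    have "rel_vol t \<ge> 0" by (simp add: rel_vol_def tube_vol_nonneg)
    then show ?case using elim by (simp add: tube_vol_div_powr mult_right_mono)
  qed
  from Lim_null_comparison[OF this 0]
  have *: "((\<lambda>t. ereal (tube_vol A t / t powr (real DIM('a) - r))) \<longlongrightarrow> ereal 0) (at_right 0)"
    by (rule tendsto_ereal)
  show "upper_content r A = 0" "lower_content r A = 0"
    using lim_imp_Limsup[OF _ *] lim_imp_Liminf[OF _ *]
    by (simp_all add: upper_content_def lower_content_def trivial_limit_at_right_real zero_ereal_def)
qed

text \<open>Positivity of \<open>G\<close> enters here: half its minimum bounds the relative volume
  from below near 0, and t^(r-D) blows up.\<close>

lemma content_below:
  assumes "r < D"
  shows "upper_content r A = \<infinity>" "lower_content r A = \<infinity>"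
proof -
  have m: "G argmin / 2 > 0" using G_pos by simp
  have "filterlim (\<lambda>x. exp ((D - r) * x)) at_top at_top"
    using assms by (intro filterlim_compose[OF exp_at_top]
        filterlim_tendsto_pos_mult_at_top[OF tendsto_const] filterlim_ident) auto
  moreover have "filterlim (\<lambda>t::real. - ln t) at_top (at_right 0)"
    using ln_at_0 by (simp add: filterlim_uminus_at_top)
  ultimately have "filterlim (\<lambda>t. exp ((D - r) * - ln t)) at_top (at_right 0)"
    by (rule filterlim_compose)
  then have "filterlim (\<lambda>t. G argmin / 2 * exp ((D - r) * - ln t)) at_top (at_right 0)"
    by (rule filterlim_tendsto_pos_mult_at_top[OF tendsto_const m])
  moreover have "\<forall>\<^sub>F t in at_right 0. G argmin / 2 * exp ((D - r) * - ln t)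
      \<le> tube_vol A t / t powr (real DIM('a) - r)"
    using rel_vol_eventually_bounds[OF m] eventually_at_right_less[of "0::real"]
  proof eventually_elim
    case (elim t)
    then have "exp ((D - r) * - ln t) = t powr (r - D)" by (simp add: powr_def algebra_simps)
    moreover have "G argmin / 2 \<le> rel_vol t" using elim by linarith
    ultimately show ?case using elim by (simp add: tube_vol_div_powr mult_right_mono)
  qed
  ultimately have "filterlim (\<lambda>t. tube_vol A t / t powr (real DIM('a) - r)) at_top (at_right 0)"
    by (rule filterlim_at_top_mono)
  then have *: "((\<lambda>t. ereal (tube_vol A t / t powr (real DIM('a) - r))) \<longlongrightarrow> \<infinity>) (at_right 0)"
    by (simp add: tendsto_PInfty_eq_at_top)
  show "upper_content r A = \<infinity>" "lower_content r A = \<infinity>"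
    using lim_imp_Limsup[OF _ *] lim_imp_Liminf[OF _ *]
    by (simp_all add: upper_content_def lower_content_def trivial_limit_at_right_real)
qed

lemma has_minkowski_dim: "has_minkowski_dim A D"
proof -
  have "upper_content r A = 0 \<longleftrightarrow> r > D" for r
    using content_above[of r] content_below[of r] upper_content_eq G_pos[of argmax]
    by (cases r D rule: linorder_cases) auto
  moreover have "lower_content r A = 0 \<longleftrightarrow> r > D" for r
    using content_above[of r] content_below[of r] lower_content_eq G_pos[of argmin]
    by (cases r D rule: linorder_cases) auto
  moreover have "{r. 0 < r \<and> D < r} = {D<..}" using D_nonneg by auto
  ultimately show ?thesis
    by (simp add: has_minkowski_dim_def upper_minkowski_dim_def lower_minkowski_dim_def
        Inf_ereal_greaterThan)
qed

lemma minkowski_nondegenerate: "minkowski_nondegenerate A"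
  unfolding minkowski_nondegenerate_def
  using D_nonneg G_pos[of argmin] G_min_less_max
  by (intro exI[of _ D]) (auto simp: lower_content_eq upper_content_eq)

text \<open>The definition allows any exponent. Away from \<open>D\<close> both contents are 0 or
  both infinite, and at \<open>D\<close> they differ because \<open>G\<close> is not
  constant.\<close>

lemma not_minkowski_measurable: "\<not> minkowski_measurable A"
proof
  assume "minkowski_measurable A"
  then obtain r where "0 < lower_content r A" "lower_content r A = upper_content r A"
    "upper_content r A < \<infinity>" by (auto simp: minkowski_measurable_def)
  then show False
    using content_above[of r] content_below[of r] lower_content_eq upper_content_eq G_min_less_max
    by (cases r D rule: linorder_cases) auto
qed

section \<open>Splitting the tube zeta function into periodic part and remainder\<close>

lemma measurable_G [measurable]: "G \<in> borel_measurable borel"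
  by (rule borel_measurable_continuous_onI[OF continuous_on_G])

lemma measurable_tube_vol [measurable]: "tube_vol A \<in> borel_measurable borel"
  by (intro borel_measurable_mono monoI tube_vol_mono A)

lemma abs_G_le: "\<bar>G x\<bar> \<le> G argmax"
  using G_max G_nonneg[of x] by simp

text \<open>\<open>\<delta>\<close> is arbitrary, while the asymptotics hold only below
  \<open>t0\<close>; the periodic part is subtracted only where both limits permit.\<close>

definition cutoff :: "real \<Rightarrow> real" where
  "cutoff \<delta> = min t0 \<delta>"

text \<open>Normalised by t^(-N) so that the zeta integrand is t^(s-1) times this density. From the
  cutoff on, the whole density counts as remainder, which is harmless away from t = 0.\<close>

definition remainder :: "real \<Rightarrow> real \<Rightarrow> real" where
  "remainder \<delta> t = tube_vol A t * t powr (- real DIM('a)) -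
     (if t < cutoff \<delta> then t powr (- D) * G (ln (1 / t)) else 0)"

text \<open>The entire function J of the overview, taken over the period starting at x = - ln of the
  cutoff.\<close>

definition period_integral :: "real \<Rightarrow> complex \<Rightarrow> complex" where
  "period_integral \<delta> z =
     integral {- ln (cutoff \<delta>)..- ln (cutoff \<delta>) + T} (\<lambda>x. exp (- z * of_real x) * of_real (G x))"

definition remainder_mellin :: "real \<Rightarrow> complex \<Rightarrow> complex" where
  "remainder_mellin \<delta> s = (LINT t:{0<..<\<delta>}|lborel. of_real t powr (s - 1) * of_real (remainder \<delta> t))"

text \<open>The remainder is multiplied by the denominator so that the extension is a single
  quotient and the remainder drops out at every zero of the denominator.\<close>

definition zeta_num :: "real \<Rightarrow> complex \<Rightarrow> complex" where
  "zeta_num \<delta> s = period_integral \<delta> (s - of_real D) +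
     remainder_mellin \<delta> s * (1 - exp (- of_real T * (s - of_real D)))"

definition zeta_ext :: "real \<Rightarrow> complex \<Rightarrow> complex" where
  "zeta_ext \<delta> s = zeta_num \<delta> s / (1 - exp (- of_real T * (s - of_real D)))"

text \<open>A candidate only: the zeros of the denominator, which are genuine poles exactly when the
  Fourier coefficient is nonzero.\<close>

definition pole :: "int \<Rightarrow> complex" where
  "pole k = of_real D + of_real (2 * pi / T) * \<i> * of_int k"

lemma measurable_remainder [measurable]: "remainder \<delta> \<in> borel_measurable borel"
  unfolding remainder_def by measurable

lemma tube_vol_powr: "t > 0 \<Longrightarrow> tube_vol A t * t powr (- real DIM('a)) = t powr (- D) * rel_vol t"
  by (simp add: rel_vol_def powr_diff powr_minus field_simps)

lemma cutoff_pos: "\<delta> > 0 \<Longrightarrow> cutoff \<delta> > 0" and cutoff_le: "cutoff \<delta> \<le> \<delta>" "cutoff \<delta> \<le> t0"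
  using t0_pos by (auto simp: cutoff_def)

text \<open>Below the cutoff this is the hypothesis on the error. Above it the density is bounded
  and the power of t is bounded below by a positive constant, so a larger factor suffices.\<close>

lemma remainder_bound:
  assumes \<delta>: "\<delta> > 0"
  obtains K where "\<And>t. 0 < t \<Longrightarrow> t < \<delta> \<Longrightarrow> \<bar>remainder \<delta> t\<bar> \<le> K * t powr (- (D - \<alpha>))"
proof
  define b where "b = cutoff \<delta>"
  have b: "0 < b" "b \<le> \<delta>" "b \<le> t0" using cutoff_pos cutoff_le \<delta> by (auto simp: b_def)
  \<comment> \<open>t^(\<open>\<alpha> - D\<close>) is monotone, in a direction depending on the
    sign of the exponent; the smaller endpoint value bounds it from below in either case.\<close>
  define m where "m = min (b powr (\<alpha> - D)) (\<delta> powr (\<alpha> - D))"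
  have m: "m > 0" using b \<delta> by (simp add: m_def)
  define K' where "K' = tube_vol A \<delta> * b powr (- real DIM('a))"
  have K': "K' \<ge> 0" by (simp add: K'_def tube_vol_nonneg)
  fix t assume t: "0 < t" "t < \<delta>"
  show "\<bar>remainder \<delta> t\<bar> \<le> max C (K' / m) * t powr (- (D - \<alpha>))"
  proof (cases "t < b")
    case True
    have "\<bar>remainder \<delta> t\<bar> = t powr (- D) * \<bar>rel_vol t - G (ln (1 / t))\<bar>"
      using True t by (simp add: remainder_def b_def tube_vol_powr abs_mult flip: right_diff_distrib)
    also have "\<dots> \<le> t powr (- D) * (C * t powr \<alpha>)"
      using rel_vol_bound[of t] t True b by (intro mult_left_mono) (auto simp: rel_vol_def)
    also have "\<dots> = C * t powr (- (D - \<alpha>))"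
      by (simp add: mult.left_commute flip: powr_add)
    also have "\<dots> \<le> max C (K' / m) * t powr (- (D - \<alpha>))"
      by (intro mult_right_mono) auto
    finally show ?thesis .
  next
    case False
    have "\<bar>remainder \<delta> t\<bar> = tube_vol A t * t powr (- real DIM('a))"
      using False by (simp add: remainder_def b_def tube_vol_nonneg)
    also have "\<dots> \<le> K'"
      unfolding K'_def using t False b
      by (intro mult_mono tube_vol_mono A powr_mono2') (auto simp: tube_vol_nonneg)
    also have "\<dots> = K' / m * m" using m by simp
    also have "\<dots> \<le> K' / m * t powr (- (D - \<alpha>))"
    proof (rule mult_left_mono)
      show "m \<le> t powr (- (D - \<alpha>))"
      proof (cases "\<alpha> - D \<ge> 0")
        case True
        then have "b powr (\<alpha> - D) \<le> t powr (\<alpha> - D)" using b False by (intro powr_mono2) auto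
        then show ?thesis by (simp add: m_def)
      next
        case neg: False
        then have "\<delta> powr (\<alpha> - D) \<le> t powr (\<alpha> - D)" using t by (intro powr_mono2') auto
        then show ?thesis by (simp add: m_def)
      qed
    qed (use K' m in auto)
    also have "\<dots> \<le> max C (K' / m) * t powr (- (D - \<alpha>))"
      by (intro mult_right_mono) auto
    finally show ?thesis .
  qed
qed

lemma remainder_mellin_holomorphic:
  assumes "\<delta> > 0"
  shows "remainder_mellin \<delta> holomorphic_on {s. Re s > D - \<alpha>}"
proof -
  obtain K where "\<And>t. 0 < t \<Longrightarrow> t < \<delta> \<Longrightarrow> \<bar>remainder \<delta> t\<bar> \<le> K * t powr (- (D - \<alpha>))"
    using remainder_bound[OF assms] by blast
  from mellin_holomorphic[OF measurable_remainder this] show ?thesis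
    by (simp add: remainder_mellin_def[abs_def])
qed

lemma period_integral_holomorphic: "period_integral \<delta> holomorphic_on UNIV"
proof -
  let ?b = "- ln (cutoff \<delta>)"
  have "(\<lambda>z. integral (cbox ?b (?b + T)) (\<lambda>x. exp (- z * of_real x) * of_real (G x))) holomorphic_on UNIV"
  proof (rule leibniz_rule_holomorphic)
    show "((\<lambda>z. exp (- z * of_real x) * of_real (G x)) has_field_derivative
        - of_real x * exp (- z * of_real x) * of_real (G x)) (at z within UNIV)" for z x
      by (auto intro!: derivative_eq_intros)
    show "(\<lambda>x. exp (- z * complex_of_real x) * of_real (G x)) integrable_on cbox ?b (?b + T)" for z
      by (intro integrable_continuous continuous_intros continuous_on_subset[OF continuous_on_G]) auto
    show "continuous_on (UNIV \<times> cbox ?b (?b + T))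
        (\<lambda>(z :: complex, x). - of_real x * exp (- z * of_real x) * of_real (G x))"
      unfolding case_prod_unfold
      by (intro continuous_intros continuous_on_compose2[OF continuous_on_G]) auto
  qed simp
  then show ?thesis by (simp add: period_integral_def[abs_def])
qed

lemma zeta_num_holomorphic:
  assumes "\<delta> > 0"
  shows "zeta_num \<delta> holomorphic_on {s. Re s > D - \<alpha>}"
proof -
  have "(period_integral \<delta> \<circ> (\<lambda>s. s - of_real D)) holomorphic_on {s. Re s > D - \<alpha>}"
    by (intro holomorphic_on_compose holomorphic_intros
        holomorphic_on_subset[OF period_integral_holomorphic]) auto
  then show ?thesis
    unfolding zeta_num_def[abs_def] o_def
    by (intro holomorphic_intros remainder_mellin_holomorphic assms)
qed

lemma denominator_eq_0_iff: "1 - exp (- of_real T * (s - of_real D)) = 0 \<longleftrightarrow> s \<in> range pole"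
proof
  assume "1 - exp (- of_real T * (s - of_real D)) = 0"
  then have "exp (- of_real T * (s - of_real D)) = 1" by simp
  then obtain n :: int where n: "Re (- of_real T * (s - of_real D)) = 0"
      "Im (- of_real T * (s - of_real D)) = of_int (2 * n) * pi"
    unfolding exp_eq_1 by blast
  have "Re s = Re (pole (- n))" using n(1) T_pos by (simp add: pole_def)
  moreover have "Im s = Im (pole (- n))" using n(2) T_pos by (simp add: pole_def field_simps)
  ultimately have "s = pole (- n)" by (rule complex_eqI)
  then show "s \<in> range pole" by simp
next
  assume "s \<in> range pole"
  then obtain k where k: "s = pole k" by blast
  have "- of_real T * (s - of_real D) = 2 * of_real pi * \<i> * of_int (- k)"
    using T_pos by (simp add: k pole_def)
  then show "1 - exp (- of_real T * (s - of_real D)) = 0"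
    by (simp only: exp_two_pi_int) simp
qed

text \<open>The remainder is multiplied by 0 here, and the integrand of the period integral is
  periodic, so the value is independent of \<open>\<delta>\<close>.\<close>

lemma zeta_num_pole:
  "zeta_num \<delta> (pole k) = fourier_coeff T G k"
proof -
  have "zeta_num \<delta> (pole k) = period_integral \<delta> (pole k - of_real D)"
    using denominator_eq_0_iff[of "pole k"] by (simp add: zeta_num_def)
  also have "pole k - of_real D = 2 * of_real pi * \<i> * of_int k / of_real T"
    by (simp add: pole_def)
  also have "period_integral \<delta> \<dots> = fourier_coeff T G k"
    unfolding period_integral_def
    by (rule integral_period_eq_fourier_coeff[OF continuous_on_G G_periodic T_pos])
  finally show ?thesis .
qed

lemma tube_zeta_integrand:
  assumes "t \<in> {0<..<\<delta>}"
  shows "complex_of_real t powr (s - of_nat DIM('a) - 1) * of_real (tube_vol A t) =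
    of_real t powr (s - 1) * of_real (remainder \<delta> t) +
    indicator {0<..<cutoff \<delta>} t *\<^sub>R (of_real t powr (s - of_real D - 1) * of_real (G (ln (1 / t))))"
    (is "?L = ?R")
proof -
  have t: "t > 0" using assms by simp
  have pw: "complex_of_real t powr (s - of_real c - 1) = of_real t powr (s - 1) * of_real (t powr (- c))" for c
  proof -
    have "exp ((s - of_real c - 1) * of_real (ln t)) =
        exp ((s - 1) * of_real (ln t)) * exp (of_real (- c * ln t))"
      unfolding exp_add[symmetric] by (simp add: algebra_simps)
    moreover have "complex_of_real (t powr (- c)) = exp (of_real (- c * ln t))"
      unfolding exp_of_real using t by (simp add: powr_def)
    ultimately show ?thesis unfolding of_real_powr_eq_exp[OF t] by (simp only:)
  qed
  have "?L = of_real t powr (s - 1) * of_real (tube_vol A t * t powr (- real DIM('a)))"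
    using pw[of "real DIM('a)"] by simp
  also have "tube_vol A t * t powr (- real DIM('a)) =
      remainder \<delta> t + indicator {0<..<cutoff \<delta>} t * (t powr (- D) * G (ln (1 / t)))"
    using t by (simp add: remainder_def indicator_def)
  finally show ?thesis
    using pw[of D] by (simp add: algebra_simps indicator_def)
qed

text \<open>Right of \<open>D\<close> the transforms of both parts converge absolutely, so the
  identity is one between integrals. The division is legitimate because all zeros of the denominator
  have real part \<open>D\<close>.\<close>

lemma
  assumes \<delta>: "\<delta> > 0" and s: "Re s > D"
  shows tube_zeta_integrable: "set_integrable lborel {0<..<\<delta>}
      (\<lambda>t. complex_of_real t powr (s - of_nat DIM('a) - 1) * of_real (tube_vol A t))"
    and tube_zeta_eq: "tube_zeta \<delta> A s = zeta_ext \<delta> s"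
proof -
  let ?f = "\<lambda>t. complex_of_real t powr (s - 1) * of_real (remainder \<delta> t)"
  let ?g = "\<lambda>t. complex_of_real t powr (s - of_real D - 1) * of_real (G (ln (1 / t)))"
  obtain K where K: "\<And>t. 0 < t \<Longrightarrow> t < \<delta> \<Longrightarrow> \<bar>remainder \<delta> t\<bar> \<le> K * t powr (- (D - \<alpha>))"
    using remainder_bound[OF \<delta>] by blast
  have f: "set_integrable lborel {0<..<\<delta>} ?f"
    by (rule mellin_integrable[OF measurable_remainder K]) (use s alpha_pos in auto)
  have mG: "(\<lambda>t. G (ln (1 / t))) \<in> borel_measurable borel" by measurable
  have g0: "set_integrable lborel {0<..<cutoff \<delta>} ?g"
  proof (rule mellin_integrable[OF mG])
    show "\<bar>G (ln (1 / t))\<bar> \<le> G argmax * t powr (- 0)" if "0 < t" for t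
      using abs_G_le that by simp
    show "0 < Re (s - of_real D)" using s by simp
  qed
  \<comment> \<open>Since the cutoff is at most \<open>\<delta>\<close>, the inner indicator alone
    decides; this lets the periodic part pass between the two intervals.\<close>
  have ind: "indicat_real {0<..<\<delta>} t *\<^sub>R (indicat_real {0<..<cutoff \<delta>} t *\<^sub>R c) =
      indicat_real {0<..<cutoff \<delta>} t *\<^sub>R c" for t and c :: complex
    using cutoff_le(1)[of \<delta>] by (auto simp: indicator_def)
  have g: "set_integrable lborel {0<..<\<delta>} (\<lambda>t. indicat_real {0<..<cutoff \<delta>} t *\<^sub>R ?g t)"
    using g0 unfolding set_integrable_def ind .
  have "set_integrable lborel {0<..<\<delta>} (\<lambda>t. ?f t + indicat_real {0<..<cutoff \<delta>} t *\<^sub>R ?g t)"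
    using f g by (rule set_integral_add(1))
  then show "set_integrable lborel {0<..<\<delta>}
      (\<lambda>t. complex_of_real t powr (s - of_nat DIM('a) - 1) * of_real (tube_vol A t))"
    by (subst set_integrable_cong[OF refl refl tube_zeta_integrand])
  have "tube_zeta \<delta> A s = (LINT t:{0<..<\<delta>}|lborel. ?f t + indicat_real {0<..<cutoff \<delta>} t *\<^sub>R ?g t)"
    unfolding tube_zeta_def by (intro set_lebesgue_integral_cong ballI allI impI tube_zeta_integrand) auto
  also have "\<dots> = remainder_mellin \<delta> s + (LINT t:{0<..<cutoff \<delta>}|lborel. ?g t)"
    using set_integral_add(2)[OF f g]
    unfolding remainder_mellin_def set_lebesgue_integral_def ind .
  finally have 1: "tube_zeta \<delta> A s = remainder_mellin \<delta> s + (LINT t:{0<..<cutoff \<delta>}|lborel. ?g t)" .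
  have 2: "(1 - exp (- of_real T * (s - of_real D))) * (LINT t:{0<..<cutoff \<delta>}|lborel. ?g t) =
      period_integral \<delta> (s - of_real D)"
    unfolding period_integral_def
    by (rule mellin_log_periodic[OF continuous_on_G G_periodic T_pos abs_G_le cutoff_pos[OF \<delta>]])
       (use s in simp)
  have nz: "1 - exp (- of_real T * (s - of_real D)) \<noteq> 0"
    using s T_pos by (subst denominator_eq_0_iff) (auto simp: pole_def)
  show "tube_zeta \<delta> A s = zeta_ext \<delta> s"
    unfolding zeta_ext_def zeta_num_def 1 2[symmetric] using nz by (simp add: field_simps)
qed

text \<open>Near 0 the integrand dominates a positive multiple of 1/t, including at
  \<open>\<sigma>\<close> = \<open>D\<close>, because the relative volume stays above a positive
  constant.\<close>

lemma tube_zeta_not_integrable: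
  assumes \<delta>: "\<delta> > 0" and \<sigma>: "\<sigma> \<le> D"
  shows "\<not> set_integrable lborel {0<..<\<delta>} (\<lambda>t. t powr (\<sigma> - real DIM('a) - 1) * tube_vol A t)"
proof
  assume int: "set_integrable lborel {0<..<\<delta>} (\<lambda>t. t powr (\<sigma> - real DIM('a) - 1) * tube_vol A t)"
  define m where "m = G argmin / 2"
  have m: "m > 0" using G_pos by (simp add: m_def)
  obtain c where c: "c > 0" "\<And>t. 0 < t \<Longrightarrow> t < c \<Longrightarrow> G argmin - m < rel_vol t"
    using rel_vol_eventually_bounds[OF m] unfolding eventually_at_right_field by auto
  \<comment> \<open>Below \<open>c\<close> the relative volume exceeds \<open>m\<close>; the bound 1
    ensures that t^(\<open>\<sigma> - D - 1\<close>) is at least 1/t when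
    \<open>\<sigma> \<le> D\<close>.\<close>
  define b where "b = min (min c \<delta>) 1"
  have b: "b > 0" "b \<le> c" "b \<le> \<delta>" "b \<le> 1" using c \<delta> by (auto simp: b_def)
  have "set_integrable lborel {0<..<b} (\<lambda>t. t powr (\<sigma> - real DIM('a) - 1) * tube_vol A t)"
    by (rule set_integrable_subset[OF int]) (use b in auto)
  then have "set_integrable lborel {0<..<b} (\<lambda>t. m * (1 / t))"
  proof (rule set_integrable_bound)
    show "set_borel_measurable lborel {0<..<b} (\<lambda>t. m * (1 / t))"
      unfolding set_borel_measurable_def by measurable
    have "norm (m * (1 / t)) \<le> norm (t powr (\<sigma> - real DIM('a) - 1) * tube_vol A t)" if t: "t \<in> {0<..<b}" for t
    proof -
      have "m < rel_vol t" using c(2)[of t] t b by (simp add: m_def)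
      have "m * (1 / t) \<le> rel_vol t * t powr (\<sigma> - D - 1)"
      proof (rule mult_mono)
        have "t powr (- 1) \<le> t powr (\<sigma> - D - 1)"
          using t b \<sigma> by (intro powr_mono') auto
        then show "1 / t \<le> t powr (\<sigma> - D - 1)"
          using t by (simp add: powr_minus inverse_eq_divide)
      qed (use \<open>m < rel_vol t\<close> m t in auto)
      also have "\<dots> = t powr (\<sigma> - real DIM('a) - 1) * tube_vol A t"
      proof -
        have "t powr (\<sigma> - D - 1) = t powr (\<sigma> - real DIM('a) - 1) * t powr (real DIM('a) - D)"
          unfolding powr_add[symmetric] by (rule arg_cong[where f = "(powr) t"]) simp
        then show ?thesis using t by (simp add: rel_vol_def)
      qed
      finally show ?thesis using m t by (simp add: abs_mult tube_vol_nonneg)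
    qed
    then show "AE t in lborel. t \<in> {0<..<b} \<longrightarrow>
        norm (m * (1 / t)) \<le> norm (t powr (\<sigma> - real DIM('a) - 1) * tube_vol A t)" by simp
  qed
  then have "set_integrable lborel {0<..<b} (\<lambda>t. 1 / t)"
    using m by (subst (asm) set_integrable_mult_right_iff) auto
  then show False using not_set_integrable_inverse[OF b(1)] by blast
qed

lemma tube_zeta_abscissa_eq:
  assumes \<delta>: "\<delta> > 0"
  shows "tube_zeta_abscissa \<delta> A = ereal D"
proof -
  have "set_integrable lborel {0<..<\<delta>} (\<lambda>t. t powr (\<sigma> - real DIM('a) - 1) * tube_vol A t)" if "\<sigma> > D" for \<sigma>
  proof -
    \<comment> \<open>For real \<open>\<sigma>\<close> the norm of the complex integrand is the
      nonnegative real integrand of the abscissa.\<close>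
    have "set_integrable lborel {0<..<\<delta>}
      (\<lambda>t. norm (complex_of_real t powr (of_real \<sigma> - of_nat DIM('a) - 1) * of_real (tube_vol A t)))"
      using tube_zeta_integrable[OF \<delta>, of "of_real \<sigma>"] that by (intro set_integrable_norm) auto
    then show ?thesis
      by (subst (asm) set_integrable_cong[OF refl, where f' = "\<lambda>t. t powr (\<sigma> - real DIM('a) - 1) * tube_vol A t"])
         (auto simp: norm_mult norm_powr_real_powr tube_vol_nonneg)
  qed
  then have "{\<sigma>. \<sigma> \<ge> 0 \<and> set_integrable lborel {0<..<\<delta>} (\<lambda>t. t powr (\<sigma> - real DIM('a) - 1) * tube_vol A t)} = {D<..}"
    using tube_zeta_not_integrable[OF \<delta>] D_nonneg by (force simp: not_le[symmetric])
  then show ?thesis by (simp add: tube_zeta_abscissa_def Inf_ereal_greaterThan)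
qed

section \<open>Poles, residues and uniqueness of the extension\<close>

lemma denominator_deriv:
  "((\<lambda>s. 1 - exp (- of_real T * (s - of_real D))) has_field_derivative of_real T) (at (pole k))"
proof -
  have "exp (- of_real T * (pole k - of_real D)) = 1"
    using denominator_eq_0_iff[of "pole k"] by simp
  then show ?thesis
    by (auto intro!: derivative_eq_intros)
qed

lemma Re_pole [simp]: "Re (pole k) = D" and pole_0 [simp]: "pole 0 = of_real D"
  by (simp_all add: pole_def)

lemma inj_pole: "pole j = pole k \<longleftrightarrow> j = k"
  using T_pos by (auto simp: pole_def)

lemma pole_in_half_plane: "pole k \<in> {s. Re s > D - \<alpha>}"
  using alpha_pos by simp

lemma denominator_holomorphic: "(\<lambda>s. 1 - exp (- of_real T * (s - of_real D))) holomorphic_on S"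
  by (intro holomorphic_intros)

lemma zeta_ext_meromorphic:
  assumes "\<delta> > 0"
  shows "zeta_ext \<delta> meromorphic_on {s. Re s > D - \<alpha>}"
  unfolding zeta_ext_def[abs_def]
  using zeta_num_holomorphic[OF assms] denominator_holomorphic open_half_plane_Re(1)
  by (intro meromorphic_on_divide analytic_on_imp_meromorphic_on) (auto simp: analytic_on_open)

lemma zeta_ext_isolated:
  assumes "\<delta> > 0" "Re s > D - \<alpha>"
  shows "isolated_singularity_at (zeta_ext \<delta>) s"
  using meromorphic_on_isolated_singularity[OF meromorphic_on_subset[OF zeta_ext_meromorphic[OF assms(1)]], of s]
    assms(2) by simp

lemma zeta_ext_analytic:
  assumes "\<delta> > 0" "Re s > D - \<alpha>" "s \<notin> range pole"
  shows "zeta_ext \<delta> analytic_on {s}"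
proof -
  have "zeta_num \<delta> analytic_on {s}"
    using zeta_num_holomorphic[OF assms(1)] open_half_plane_Re(1) assms(2)
    by (intro holomorphic_on_imp_analytic_at) auto
  moreover have "(\<lambda>s. 1 - exp (- of_real T * (s - of_real D))) analytic_on {s}"
    using denominator_holomorphic[of UNIV] by (intro holomorphic_on_imp_analytic_at) auto
  ultimately show ?thesis
    unfolding zeta_ext_def[abs_def]
    using assms(3) denominator_eq_0_iff[of s] by (intro analytic_on_divide) auto
qed

text \<open>The denominator has derivative \<open>T\<close> at each of its zeros, which makes them
  simple and accounts for the division by \<open>T\<close> in the residue.\<close>

lemma
  assumes "\<delta> > 0"
  shows zeta_ext_is_pole_iff: "is_pole (zeta_ext \<delta>) (pole k) \<longleftrightarrow> fourier_coeff T G k \<noteq> 0"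
    and zeta_ext_zorder: "fourier_coeff T G k \<noteq> 0 \<Longrightarrow> zorder (zeta_ext \<delta>) (pole k) = - 1"
    and zeta_ext_residue: "residue (zeta_ext \<delta>) (pole k) = fourier_coeff T G k / of_real T"
proof -
  have 0: "1 - exp (- of_real T * (pole k - of_real D)) = 0"
    by (subst denominator_eq_0_iff) simp
  have T0: "complex_of_real T \<noteq> 0" using T_pos by simp
  note * = simple_quotient_at_zero[OF zeta_num_holomorphic[OF assms] denominator_holomorphic
      open_half_plane_Re pole_in_half_plane denominator_deriv 0 T0, unfolded zeta_num_pole]
  have eq: "zeta_ext \<delta> = (\<lambda>w. zeta_num \<delta> w / (1 - exp (- of_real T * (w - of_real D))))"
    by (rule ext) (rule zeta_ext_def)
  show "is_pole (zeta_ext \<delta>) (pole k) \<longleftrightarrow> fourier_coeff T G k \<noteq> 0"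
    "fourier_coeff T G k \<noteq> 0 \<Longrightarrow> zorder (zeta_ext \<delta>) (pole k) = - 1"
    "residue (zeta_ext \<delta>) (pole k) = fourier_coeff T G k / of_real T"
    unfolding eq by (rule *(1), rule *(2), assumption, rule *(3))
qed

text \<open>The raw quotient takes the value 0 wherever its denominator vanishes, also at removable
  singularities. \<open>remove_sings\<close> puts the limit there and leaves 0 at poles, as nice
  meromorphy demands.\<close>

definition Z :: "real \<Rightarrow> complex \<Rightarrow> complex" where
  "Z \<delta> = remove_sings (zeta_ext \<delta>)"

lemma Z_meromorphic_extension:
  assumes "\<delta> > 0"
  shows "meromorphic_extension (tube_zeta \<delta> A) {s. Re s > D} {s. Re s > D - \<alpha>} (Z \<delta>)"
  unfolding meromorphic_extension_def
proof (intro conjI ballI)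
  show "{s. Re s > D} \<subseteq> {s. Re s > D - \<alpha>}" using alpha_pos by auto
  show "Z \<delta> nicely_meromorphic_on {s. Re s > D - \<alpha>}"
    unfolding Z_def by (rule remove_sings_nicely_meromorphic[OF zeta_ext_meromorphic[OF assms]])
  fix s assume s: "s \<in> {s. Re s > D}"
  then have "zeta_ext \<delta> analytic_on {s}"
    using alpha_pos by (intro zeta_ext_analytic assms) auto
  then show "Z \<delta> s = tube_zeta \<delta> A s"
    using tube_zeta_eq[OF assms, of s] s by (simp add: Z_def)
qed

lemma meromorphic_extension_unique:
  assumes "\<delta> > 0" and Z': "meromorphic_extension (tube_zeta \<delta> A) {s. Re s > D} {s. Re s > D - \<alpha>} Z'"
    and z: "Re z > D - \<alpha>"
  shows "Z' z = Z \<delta> z"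
proof (rule nicely_meromorphic_on_unique[where U = "{s. Re s > D}" and V = "{s. Re s > D - \<alpha>}" and f = Z' and g = "Z \<delta>" and z = z])
  have "of_real (D + 1) \<in> {s. Re s > D}" by simp
  then show "{s. Re s > D} \<noteq> {}" by (metis empty_iff)
  show "Z' s = Z \<delta> s" if "s \<in> {s. Re s > D}" for s
    using Z' Z_meromorphic_extension[OF assms(1)] that by (simp add: meromorphic_extension_def)
qed (use assms Z_meromorphic_extension[OF assms(1)] in
    \<open>auto simp: meromorphic_extension_def open_half_plane_Re\<close>)

lemma is_pole_Z_iff:
  assumes "\<delta> > 0" "Re s > D - \<alpha>"
  shows "is_pole (Z \<delta>) s \<longleftrightarrow> (\<exists>k. s = pole k \<and> fourier_coeff T G k \<noteq> 0)"
proof -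
  have "is_pole (Z \<delta>) s \<longleftrightarrow> is_pole (zeta_ext \<delta>) s"
    unfolding Z_def by (intro is_pole_remove_sings_iff zeta_ext_isolated assms)
  also have "\<dots> \<longleftrightarrow> (\<exists>k. s = pole k \<and> fourier_coeff T G k \<noteq> 0)"
  proof (cases "s \<in> range pole")
    case True
    then obtain k where k: "s = pole k" by blast
    show ?thesis unfolding k zeta_ext_is_pole_iff[OF assms(1)] inj_pole by blast
  next
    case False
    then have "\<not> is_pole (zeta_ext \<delta>) s"
      by (intro analytic_at_imp_no_pole zeta_ext_analytic assms)
    then show ?thesis using False by auto
  qed
  finally show ?thesis .
qed

lemma poles_in_Z:
  assumes "\<delta> > 0"
  shows "poles_in (Z \<delta>) {s. Re s > D - \<alpha>} = {pole k | k. fourier_coeff T G k \<noteq> 0}"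
  using is_pole_Z_iff[OF assms] pole_in_half_plane by (auto simp: poles_in_def)

text \<open>All candidates have real part \<open>D\<close>, the abscissa of convergence, so the
  critical line already carries every pole of the half-plane.\<close>

lemma principal_complex_dims_Z:
  assumes "\<delta> > 0"
  shows "principal_complex_dims \<delta> A (Z \<delta>) = {pole k | k. fourier_coeff T G k \<noteq> 0}"
  using is_pole_Z_iff[OF assms] alpha_pos
  by (auto simp: principal_complex_dims_def poles_in_def tube_zeta_abscissa_eq[OF assms])

lemma residue_Z:
  assumes "\<delta> > 0"
  shows "residue (Z \<delta>) (pole k) = fourier_coeff T G k / of_real T"
proof -
  have "isolated_singularity_at (zeta_ext \<delta>) (pole k)"
    using alpha_pos by (intro zeta_ext_isolated assms) simp
  then show ?thesis unfolding Z_def by (simp only: residue_remove_sings zeta_ext_residue[OF assms])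
qed

lemma zorder_Z:
  assumes "\<delta> > 0" "fourier_coeff T G k \<noteq> 0"
  shows "zorder (Z \<delta>) (pole k) = - 1"
proof -
  have "isolated_singularity_at (zeta_ext \<delta>) (pole k)"
    using alpha_pos by (intro zeta_ext_isolated assms) simp
  then show ?thesis unfolding Z_def by (simp only: zorder_remove_sings zeta_ext_zorder[OF assms])
qed

section \<open>Fourier coefficients and mean value of the profile\<close>

lemma fourier_transform_truncation:
  "fourier_transform (truncation T G) (of_int k / T) = fourier_coeff T G k"
proof -
  let ?f = "\<lambda>x. exp (- (2 * of_real pi * \<i> * of_int k / of_real T) * of_real x) * of_real (G x)"
  have "fourier_transform (truncation T G) (of_int k / T) = (LINT x:{0..T}|lborel. ?f x)"
    unfolding fourier_transform_def set_lebesgue_integral_def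
    by (intro Bochner_Integration.integral_cong) (auto simp: truncation_def indicator_def)
  also have "\<dots> = integral {0..T} ?f"
    by (intro set_borel_integral_eq_integral borel_integrable_atLeastAtMost' continuous_intros
        continuous_on_subset[OF continuous_on_G]) auto
  finally show ?thesis by (simp add: fourier_coeff_def)
qed

lemma set_integrable_G: "set_integrable lborel {0..T} G"
  by (intro borel_integrable_atLeastAtMost' continuous_on_subset[OF continuous_on_G]) auto

lemma integral_G: "(LINT x:{0..T}|lborel. G x) = integral {0..T} G"
  by (rule set_borel_integral_eq_integral(2)[OF set_integrable_G])

lemma G_integrable: "G integrable_on {0..T}"
  by (rule set_borel_integral_eq_integral(1)[OF set_integrable_G])

lemma fourier_coeff_0: "fourier_coeff T G 0 = of_real (integral {0..T} G)"
  using integral_linear[OF G_integrable bounded_linear_of_real[where 'a = complex]]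
  by (simp add: fourier_coeff_def o_def)

lemma fourier_coeff_integrand_integrable:
  "(\<lambda>x. exp (- (2 * of_real pi * \<i> * of_int k / of_real T) * complex_of_real x) * of_real (G x)) integrable_on {0..T}"
  by (intro integrable_continuous_real continuous_intros continuous_on_subset[OF continuous_on_G]) auto

lemma norm_fourier_coeff_le: "norm (fourier_coeff T G k) \<le> integral {0..T} G"
  unfolding fourier_coeff_def
proof (rule integral_norm_bound_integral[OF fourier_coeff_integrand_integrable G_integrable])
  fix x
  have "norm (exp (- (2 * of_real pi * \<i> * of_int k / of_real T) * complex_of_real x)) = 1"
    by (simp add: norm_exp_eq_Re)
  then show "norm (exp (- (2 * of_real pi * \<i> * of_int k / of_real T) * complex_of_real x) * of_real (G x)) \<le> G x"
    by (simp only: norm_mult) (simp add: G_nonneg)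
qed

text \<open>Holds because \<open>G\<close> is real; it makes the set of indices with nonzero
  coefficient symmetric, which pairs the poles.\<close>

lemma fourier_coeff_minus: "fourier_coeff T G (- k) = cnj (fourier_coeff T G k)"
proof -
  have "cnj (fourier_coeff T G k) = integral {0..T}
    (\<lambda>x. cnj (exp (- (2 * of_real pi * \<i> * of_int k / of_real T) * of_real x) * of_real (G x)))"
    unfolding fourier_coeff_def
    using integral_linear[OF fourier_coeff_integrand_integrable bounded_linear_cnj, of k]
    by (simp add: o_def)
  also have "\<dots> = fourier_coeff T G (- k)"
    unfolding fourier_coeff_def by (simp add: exp_cnj)
  finally show ?thesis ..
qed

text \<open>Strictness: a continuous nonnegative function that is nonzero somewhere has positive
  integral. The period is moved to start at such a point; for the two differences with the extrema
  it is \<open>argmax\<close> and \<open>argmin\<close> respectively.\<close>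

lemma mean_bounds: "T * G argmin < integral {0..T} G" "integral {0..T} G < T * G argmax"
proof -
  have pos: "integral {0..T} h > 0"
    if h: "continuous_on UNIV h" "\<And>x. h x \<ge> 0" "h y \<noteq> 0" "\<And>x. h (x + T) = h x" for h :: "real \<Rightarrow> real" and y
  proof -
    have "integral {0..T} h = integral {y..y + T} h"
      by (rule integral_periodic[OF h(1,4) T_pos, symmetric])
    moreover have "integral {y..y + T} h \<ge> 0"
      by (intro integral_nonneg integrable_continuous_real continuous_on_subset[OF h(1)] h(2)) auto
    moreover have "integral {y..y + T} h \<noteq> 0"
      using integral_eq_0_iff[OF continuous_on_subset[OF h(1)], of y "y + T"] h(2,3) T_pos by force
    ultimately show ?thesis by linarith
  qed
  have diff: "integral {0..T} (\<lambda>x. G x - c) = integral {0..T} G - T * c"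
    "integral {0..T} (\<lambda>x. c - G x) = T * c - integral {0..T} G" for c
    using T_pos Henstock_Kurzweil_Integration.integral_diff[OF G_integrable integrable_const_ivl, of c]
      Henstock_Kurzweil_Integration.integral_diff[OF integrable_const_ivl G_integrable, of c] by simp_all
  have "integral {0..T} (\<lambda>x. G x - G argmin) > 0"
    by (rule pos[of _ argmax])
       (use G_min G_min_less_max in \<open>auto intro!: continuous_intros continuous_on_G simp: G_periodic\<close>)
  then show "T * G argmin < integral {0..T} G"
    by (simp add: diff)
  have "integral {0..T} (\<lambda>x. G argmax - G x) > 0"
    by (rule pos[of _ argmin])
       (use G_max G_min_less_max in \<open>auto intro!: continuous_intros continuous_on_G simp: G_periodic\<close>)
  then show "integral {0..T} G < T * G argmax"
    by (simp add: diff)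
qed

lemma residues_tendsto_0:
  assumes \<delta>: "\<delta> > 0"
  shows "((\<lambda>k. residue (Z \<delta>) (pole k)) \<longlongrightarrow> 0) at_top" "((\<lambda>k. residue (Z \<delta>) (pole k)) \<longlongrightarrow> 0) at_bot"
proof -
  have small: "\<exists>n::nat. \<forall>k. \<bar>k\<bar> \<ge> int n \<longrightarrow> dist (residue (Z \<delta>) (pole k)) 0 < e" if "e > 0" for e
  proof -
    have "e * T > 0" using that T_pos by simp
    from riemann_lebesgue_periodic[OF continuous_on_G G_periodic T_pos this]
    obtain n :: nat where n: "\<forall>k. \<bar>k\<bar> \<ge> int n \<longrightarrow> norm (fourier_coeff T G k) < e * T" ..
    show ?thesis
      using n T_pos by (intro exI[of _ n]) (simp add: residue_Z[OF \<delta>] norm_divide field_simps)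
  qed
  show "((\<lambda>k. residue (Z \<delta>) (pole k)) \<longlongrightarrow> 0) at_top"
  proof (rule tendstoI)
    fix e :: real assume "e > 0"
    then obtain n where n: "\<forall>k. \<bar>k\<bar> \<ge> int n \<longrightarrow> dist (residue (Z \<delta>) (pole k)) 0 < e" using small by blast
    show "\<forall>\<^sub>F k in at_top. dist (residue (Z \<delta>) (pole k)) 0 < e"
      using eventually_ge_at_top[of "int n"] by eventually_elim (use n in auto)
  qed
  show "((\<lambda>k. residue (Z \<delta>) (pole k)) \<longlongrightarrow> 0) at_bot"
  proof (rule tendstoI)
    fix e :: real assume "e > 0"
    then obtain n where n: "\<forall>k. \<bar>k\<bar> \<ge> int n \<longrightarrow> dist (residue (Z \<delta>) (pole k)) 0 < e" using small by blast
    show "\<forall>\<^sub>F k in at_bot. dist (residue (Z \<delta>) (pole k)) 0 < e"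
      using eventually_le_at_bot[of "- int n"] by eventually_elim (use n in auto)
  qed
qed

lemma mer_abscissa_le:
  assumes "\<delta> > 0"
  shows "mer_abscissa (tube_zeta \<delta> A) {s. Re s > D} \<le> ereal (D - \<alpha>)"
  unfolding mer_abscissa_def
  using Z_meromorphic_extension[OF assms] by (intro Inf_lower) (auto simp: half_plane_ereal)

end

theorem theorem4p4:
  fixes A :: "(real ^ 'n) set" and D \<alpha> T \<delta> :: real and G E :: "real \<Rightarrow> real"
  assumes "A \<noteq> {}" and "bounded A"
    and "D \<ge> 0" and "\<alpha> > 0" and "\<delta> > 0"
    and "\<And>x. G x \<ge> 0" and "\<not> G constant_on UNIV" and "minimal_period G T"
    and "E \<in> O[at_right 0](\<lambda>t. t powr \<alpha>)"
    and "\<forall>\<^sub>F t in at_right 0.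
           tube_vol A t = t powr (real CARD('n) - D) * (G (ln (1 / t)) + E t)"
  shows "has_minkowski_dim A D \<and>
    continuous_on UNIV G \<and>
    minkowski_nondegenerate A \<and>
    0 < lower_content D A \<and>
    (\<exists>\<tau>. lower_content D A = ereal (G \<tau>) \<and> (\<forall>x. G \<tau> \<le> G x)) \<and>
    (\<exists>\<tau>. upper_content D A = ereal (G \<tau>) \<and> (\<forall>x. G x \<le> G \<tau>)) \<and>
    (\<lambda>\<tau>. ereal (G \<tau>)) ` {0..T} = {lower_content D A..upper_content D A} \<and>
    tube_zeta_abscissa \<delta> A = ereal D \<and>
    mer_abscissa (tube_zeta \<delta> A) (half_plane (tube_zeta_abscissa \<delta> A)) \<le> ereal (D - \<alpha>) \<and>
    (\<exists>Z. let U = half_plane (tube_zeta_abscissa \<delta> A);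
             V = half_plane (ereal (D - \<alpha>));
             s = (\<lambda>k::int. of_real D + of_real (2 * pi / T) * \<i> * of_int k);
             P = poles_in Z V;
             G0hat = fourier_transform (truncation T G)
         in meromorphic_extension (tube_zeta \<delta> A) U V Z \<and>
            (\<forall>Z'. meromorphic_extension (tube_zeta \<delta> A) U V Z' \<longrightarrow> (\<forall>z\<in>V. Z' z = Z z)) \<and>
            P = {s k | k. G0hat (of_int k / T) \<noteq> 0} \<and>
            P = principal_complex_dims \<delta> A Z \<and>
            (\<forall>\<omega>\<in>P. zorder Z \<omega> = - 1) \<and>
            (\<forall>k. s k \<in> P \<longrightarrow> residue Z (s k) = 1 / of_real T * G0hat (of_int k / T)) \<and>
            (\<forall>k. s k \<in> P \<longrightarrow> s (- k) \<in> P) \<and>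
            (\<forall>k. s k \<in> P \<longrightarrow> norm (residue Z (s k)) \<le> 1 / T * (LINT \<tau>:{0..T}|lborel. G \<tau>)) \<and>
            ((\<lambda>k. residue Z (s k)) \<longlongrightarrow> 0) at_top \<and>
            ((\<lambda>k. residue Z (s k)) \<longlongrightarrow> 0) at_bot \<and>
            s 0 = of_real D \<and> of_real D \<in> P \<and>
            residue Z (of_real D) = of_real (1 / T * (LINT \<tau>:{0..T}|lborel. G \<tau>)) \<and>
            \<not> minkowski_measurable A \<and>
            lower_content D A < ereal (Re (residue Z (of_real D))) \<and>
            ereal (Re (residue Z (of_real D))) < upper_content D A \<and>
            upper_content D A < \<infinity>)"
proof -
  have T: "T > 0" "\<And>x. G (x + T) = G x"
    using assms(8) by (auto simp: minimal_period_def)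
  obtain C where C: "\<forall>\<^sub>F t in at_right 0. norm (E t) \<le> C * norm (t powr \<alpha>)"
    using assms(9) by (auto elim: landau_o.bigE)
  \<comment> \<open>Dividing by the positive power of t isolates the error function
    \<open>E\<close>, to which the big-O bound applies.\<close>
  have "\<forall>\<^sub>F t in at_right 0. 0 < t \<and>
      \<bar>tube_vol A t / t powr (real DIM(real ^ 'n) - D) - G (ln (1 / t))\<bar> \<le> C * t powr \<alpha>"
    using C assms(10) eventually_at_right_less[of "0::real"] by eventually_elim auto
  then obtain t0 where t0: "t0 > 0" "\<And>t. 0 < t \<Longrightarrow> t < t0 \<Longrightarrow>
      \<bar>tube_vol A t / t powr (real DIM(real ^ 'n) - D) - G (ln (1 / t))\<bar> \<le> C * t powr \<alpha>"
    unfolding eventually_at_right_field by auto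
  interpret log_periodic_tube A D \<alpha> T C t0 G
    by unfold_locales (fact assms T t0)+
  note \<delta> = \<open>\<delta> > 0\<close>
  let ?I = "LINT \<tau>:{0..T}|lborel. G \<tau>"
  let ?P = "{pole k | k. fourier_coeff T G k \<noteq> 0}"
  have V: "half_plane (ereal (D - \<alpha>)) = {s. Re s > D - \<alpha>}"
    and U: "half_plane (tube_zeta_abscissa \<delta> A) = {s. Re s > D}"
    by (simp_all add: half_plane_ereal tube_zeta_abscissa_eq[OF \<delta>])
  have pole_eq: "(\<lambda>k. of_real D + of_real (2 * pi / T) * \<i> * of_int k) = pole"
    by (simp add: pole_def fun_eq_iff)
  have mem: "pole k \<in> ?P \<longleftrightarrow> fourier_coeff T G k \<noteq> 0" for k
    by (auto simp: inj_pole)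
  have I_pos: "?I > 0"
    using mean_bounds(1) G_pos[of argmin] T(1) by (simp add: integral_G) (smt (verit) mult_pos_pos)
  have res0: "residue (Z \<delta>) (of_real D) = of_real (1 / T * ?I)"
    using residue_Z[OF \<delta>, of 0] by (simp add: fourier_coeff_0 integral_G)
  have D_mem: "of_real D \<in> ?P"
    using mem[of 0] I_pos by (simp add: fourier_coeff_0 integral_G)
  \<comment> \<open>The body of the existential statement for the witness \<open>Z \<delta>\<close>,
    with the half-planes, the points s k and the pole set already evaluated, so that it fits after
    the \<open>let\<close> is unfolded.\<close>
  have main: "meromorphic_extension (tube_zeta \<delta> A) {s. Re s > D} {s. Re s > D - \<alpha>} (Z \<delta>) \<and>
      (\<forall>Z'. meromorphic_extension (tube_zeta \<delta> A) {s. Re s > D} {s. Re s > D - \<alpha>} Z' \<longrightarrow>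
         (\<forall>z\<in>{s. Re s > D - \<alpha>}. Z' z = Z \<delta> z)) \<and>
      ?P = {pole k | k. fourier_transform (truncation T G) (of_int k / T) \<noteq> 0} \<and>
      ?P = principal_complex_dims \<delta> A (Z \<delta>) \<and>
      (\<forall>\<omega>\<in>?P. zorder (Z \<delta>) \<omega> = - 1) \<and>
      (\<forall>k. pole k \<in> ?P \<longrightarrow>
         residue (Z \<delta>) (pole k) = 1 / of_real T * fourier_transform (truncation T G) (of_int k / T)) \<and>
      (\<forall>k. pole k \<in> ?P \<longrightarrow> pole (- k) \<in> ?P) \<and>
      (\<forall>k. pole k \<in> ?P \<longrightarrow> norm (residue (Z \<delta>) (pole k)) \<le> 1 / T * ?I) \<and>
      ((\<lambda>k. residue (Z \<delta>) (pole k)) \<longlongrightarrow> 0) at_top \<and>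
      ((\<lambda>k. residue (Z \<delta>) (pole k)) \<longlongrightarrow> 0) at_bot \<and>
      pole 0 = of_real D \<and> of_real D \<in> ?P \<and>
      residue (Z \<delta>) (of_real D) = of_real (1 / T * ?I) \<and>
      \<not> minkowski_measurable A \<and>
      lower_content D A < ereal (Re (residue (Z \<delta>) (of_real D))) \<and>
      ereal (Re (residue (Z \<delta>) (of_real D))) < upper_content D A \<and>
      upper_content D A < \<infinity>"
  proof (intro conjI allI impI ballI)
    show "zorder (Z \<delta>) \<omega> = - 1" if "\<omega> \<in> ?P" for \<omega>
      using that zorder_Z[OF \<delta>] by auto
    show "residue (Z \<delta>) (pole k) = 1 / of_real T * fourier_transform (truncation T G) (of_int k / T)" for k
      by (simp add: residue_Z[OF \<delta>] fourier_transform_truncation)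
    show "pole (- k) \<in> ?P" if "pole k \<in> ?P" for k
      using that unfolding mem by (simp add: fourier_coeff_minus)
    show "norm (residue (Z \<delta>) (pole k)) \<le> 1 / T * ?I" for k
      using norm_fourier_coeff_le[of k] T(1)
      by (simp add: residue_Z[OF \<delta>] integral_G norm_divide divide_right_mono)
    show "lower_content D A < ereal (Re (residue (Z \<delta>) (of_real D)))"
      using mean_bounds(1) T(1) by (simp add: res0 lower_content_eq integral_G field_simps)
    show "ereal (Re (residue (Z \<delta>) (of_real D))) < upper_content D A"
      using mean_bounds(2) T(1) by (simp add: res0 upper_content_eq integral_G field_simps)
  qed (use Z_meromorphic_extension[OF \<delta>] meromorphic_extension_unique[OF \<delta>] D_mem res0
      residues_tendsto_0[OF \<delta>] not_minkowski_measurable in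
      \<open>simp_all add: principal_complex_dims_Z[OF \<delta>] fourier_transform_truncation upper_content_eq\<close>)
  have image: "(\<lambda>\<tau>. ereal (G \<tau>)) ` {0..T} = {lower_content D A..upper_content D A}"
  proof -
    have "(\<lambda>\<tau>. ereal (G \<tau>)) ` {0..T} = ereal ` {G argmin..G argmax}"
      by (simp add: image_image flip: image_G)
    also have "\<dots> = {lower_content D A..upper_content D A}"
    proof (intro equalityI subsetI)
      \<comment> \<open>Both contents are finite, so an extended real between them is real and the
        infinite cases are contradictory.\<close>
      fix x assume "x \<in> {lower_content D A..upper_content D A}"
      then show "x \<in> ereal ` {G argmin..G argmax}"
        by (cases x) (auto simp: lower_content_eq upper_content_eq)
    qed (auto simp: lower_content_eq upper_content_eq)
    finally show ?thesis .
  qed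
  show ?thesis
  proof (intro conjI)
    show "0 < lower_content D A" using G_pos by (simp add: lower_content_eq)
    show "\<exists>\<tau>. lower_content D A = ereal (G \<tau>) \<and> (\<forall>x. G \<tau> \<le> G x)"
      using lower_content_eq G_min by blast
    show "\<exists>\<tau>. upper_content D A = ereal (G \<tau>) \<and> (\<forall>x. G x \<le> G \<tau>)"
      using upper_content_eq G_max by blast
    show "mer_abscissa (tube_zeta \<delta> A) (half_plane (tube_zeta_abscissa \<delta> A)) \<le> ereal (D - \<alpha>)"
      unfolding U by (rule mer_abscissa_le[OF \<delta>])
  qed (fact has_minkowski_dim continuous_on_G minkowski_nondegenerate image tube_zeta_abscissa_eq[OF \<delta>]
      | unfold Let_def U V pole_eq, rule exI[of _ "Z \<delta>"], unfold poles_in_Z[OF \<delta>], fact main)+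
qed

end
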